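(* Let $d,n\in\mathbb N$, and let $G$ be a finitely generated group with the structure of an $\mathbf n$-group generated in degree $d$. Let $\Gamma$ be a group containing $G$ as a normal subgroup, let $\phi:\mathrm{SL}_n(\mathbb Z)\to\Gamma/G$ be a homomorphism, and let $\mathrm{SL}_n(\mathbb Z)$ act on $G^{ab}=G/[G,G]$ by $$g.(x[G,G])=\left(\widehat{\phi(g)}\,x\,\widehat{\phi(g)}^{-1}\right)[G,G]\qquad (g\in \mathrm{SL}_n(\mathbb Z),\ x\in G),$$ where $\widehat{\phi(g)}$ is any lift of $\phi(g)$ to $\Gamma$. Consider the following four conditions: (i) $G$ is partially commuting. (ii) $L(1)=G/[G,G]=G^{ab}$ has the structure of a regular $\mathrm{SL}_n(\mathbb Z)$-module of degree at most $d$ (with respect to the action of $\mathrm{SL}_n(\mathbb Z)$ on $G^{ab}$ given by $g.(x[G,G])=\left(\widehat{\phi(g)}\,x\,\widehat{\phi(g)}^{-1}\right)[G,G]$), with $\mathbf n$-grading denoted $\{L(1)^I\}_{I\subseteq\mathbf n}$. (iii) For every $I\subseteq\mathbf n$ with $|I|\geq d$, the image of $G_I$ in $G^{ab}=L(1)$ contains $\sum_{J\subseteq I}L(1)^{J}$. (iv) $G$ is weakly commuting. Let $N\in\mathbb N$, and assume that either - (i)-(iii) hold and $n\geq d(d+1)(N-1)$, or - (i)-(iv) hold and $n\geq (d+1)+(d^2-1)(N-1)$. If $\rho$ is any non-trivial homomorphism from $G$ to another group with $\ker\rho\supseteq \gamma_{N}G$, then $G$ has a $\rho$-CG sequence.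
   Context: Notation: $\mathbf n=\{1,\dots,n\}$; $\gamma_1G=G$, $\gamma_{k+1}G=[\gamma_kG,G]$. $\mathbf n$-groups: an $\mathbf n$-group is a group $G$ with a collection of subgroups $\{G_I\}_{I\subseteq\mathbf n}$ such that $G_{\mathbf n}=G$ and $G_I\subseteq G_J$ whenever $I\subseteq J$. It is generated in degree $d$ if $G=\langle G_I:|I|=d\rangle$. It is partially commuting if $G_I$ and $G_J$ commute elementwise whenever $I$ and $J$ are disjoint and $I$ consists of consecutive integers ($I=\{k,k+1,\dots,k+|I|-1\}$ for some $k$). It is weakly commuting if for any disjoint $I,J$ there is $g\in G$ such that $g^{-1}G_Ig$ commutes elementwise with $G_J$. Regular modules: an $\mathbf n$-grading of an abelian group $V$ is a collection of subgroups $\{V^I:I\subseteq\mathbf n\}$ with $\sum_{I}V^I=V$ (sum not necessarily direct); its degree is the smallest integer $k$ such that $V^I=0$ whenever $|I|>k$. Let $e_1,\dots,e_n$ be the standard basis of $\mathbb Z^n$. For $i\neq j$ in $\mathbf n$ define $E_{ij},F_{ij}\in\mathrm{SL}_n(\mathbb Z)$ by $E_{ij}:e_j\mapsto e_j+e_i$, $e_k\mapsto e_k$ for $k\neq j$; and $F_{ij}:e_i\mapsto -e_j$, $e_j\mapsto e_i$, $e_k\mapsto e_k$ for $k\neq i,j$. An $\mathrm{SL}_n(\mathbb Z)$-module $V$ with an $\mathbf n$-grading $\{V^I\}$ is regular if: (1) $E_{ij}$ acts trivially on $V^I$ if $I\cap\{i,j\}=\emptyset$; (2) if $I\subseteq\mathbf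 n$, $i\in I$, $j\in\mathbf n\setminus I$, then for any $g\in\{E_{ij}^{\pm1},E_{ji}^{\pm1}\}$ and $v\in V^I$ we have $gv-v\in V^{(I\cup\{j\})\setminus\{i\}}+V^{I\cup\{j\}}$; (3) for $I\subseteq\mathbf n$ and $i\neq j$ in $\mathbf n$, $F_{ij}V^I=V^{(i,j)I}$, where $(i,j)I$ is the image of $I$ under the transposition $(i,j)$. $\rho$-CG sequences: for a homomorphism $\rho$ from $G$ to another group, $C_\rho(G)$ is the set of all $g\in G$ such that $\rho(g)$ is a non-trivial central element of $\rho(G)$. A finite sequence $g_1,\dots,g_k$ in $G$, with $G_i:=\langle g_1,\dots,g_i\rangle$ (for this definition only), is $\rho$-centralizing if $g_1\in C_\rho(G)$ and for each $2\leq i\leq k$ there is $j<i$ with $g_j\in C_\rho(G)$ and $[g_i,g_j]\in G_{i-1}$. A $\rho$-CG ($\rho$-centralizing generating) sequence is a $\rho$-centralizing sequence whose elements generate $G$. Here $[g,h]=g^{-1}h^{-1}gh$. *)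

theory Defs
  imports
    "HOL-Algebra.Generated_Groups"
    "HOL-Combinatorics.Transposition"
    "Jordan_Normal_Form.Determinant"
begin

section \<open>Commutators and the lower central series\<close>

definition commutator :: "('a, 'b) monoid_scheme \<Rightarrow> 'a \<Rightarrow> 'a \<Rightarrow> 'a" where
  "commutator G x y = inv\<^bsub>G\<^esub> x \<otimes>\<^bsub>G\<^esub> inv\<^bsub>G\<^esub> y \<otimes>\<^bsub>G\<^esub> x \<otimes>\<^bsub>G\<^esub> y"

definition commutator_subgroup :: "('a, 'b) monoid_scheme \<Rightarrow> 'a set \<Rightarrow> 'a set \<Rightarrow> 'a set" where
  "commutator_subgroup G A B = generate G {commutator G x y | x y. x \<in> A \<and> y \<in> B}"

text \<open>The series starts at index 1, so index 0 is a junk value.\<close>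

primrec lower_central :: "('a, 'b) monoid_scheme \<Rightarrow> nat \<Rightarrow> 'a set" where
  "lower_central G 0 = carrier G"
| "lower_central G (Suc k) =
     (if k = 0 then carrier G else commutator_subgroup G (lower_central G k) (carrier G))"

definition finitely_generated :: "('a, 'b) monoid_scheme \<Rightarrow> bool" where
  "finitely_generated G \<longleftrightarrow> (\<exists>S. finite S \<and> S \<subseteq> carrier G \<and> generate G S = carrier G)"

definition commute_elementwise :: "('a, 'b) monoid_scheme \<Rightarrow> 'a set \<Rightarrow> 'a set \<Rightarrow> bool" where
  "commute_elementwise G A B \<longleftrightarrow> (\<forall>x\<in>A. \<forall>y\<in>B. x \<otimes>\<^bsub>G\<^esub> y = y \<otimes>\<^bsub>G\<^esub> x)"


section \<open>Groups with subgroups indexed by the subsets of \<open>{1..n}\<close>\<close>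

text \<open>Families indexed by subsets of \<open>{1..n}\<close> are total functions on \<^typ>\<open>nat set\<close>; only
  their values on subsets of \<open>{1..n}\<close> are ever used.\<close>

definition n_group :: "nat \<Rightarrow> ('a, 'b) monoid_scheme \<Rightarrow> (nat set \<Rightarrow> 'a set) \<Rightarrow> bool" where
  "n_group n G GI \<longleftrightarrow>
     group G \<and>
     (\<forall>I. I \<subseteq> {1..n} \<longrightarrow> subgroup (GI I) G) \<and>
     GI {1..n} = carrier G \<and>
     (\<forall>I J. I \<subseteq> J \<and> J \<subseteq> {1..n} \<longrightarrow> GI I \<subseteq> GI J)"

definition generated_in_degree ::
  "nat \<Rightarrow> nat \<Rightarrow> ('a, 'b) monoid_scheme \<Rightarrow> (nat set \<Rightarrow> 'a set) \<Rightarrow> bool" where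
  "generated_in_degree d n G GI \<longleftrightarrow>
     generate G (\<Union>I\<in>{I. I \<subseteq> {1..n} \<and> card I = d}. GI I) = carrier G"

text \<open>The empty set counts as a set of consecutive integers.\<close>

definition consecutive :: "nat set \<Rightarrow> bool" where
  "consecutive I \<longleftrightarrow> (\<exists>k. I = {k..<k + card I})"

definition partially_commuting ::
  "nat \<Rightarrow> ('a, 'b) monoid_scheme \<Rightarrow> (nat set \<Rightarrow> 'a set) \<Rightarrow> bool" where
  "partially_commuting n G GI \<longleftrightarrow>
     (\<forall>I J. I \<subseteq> {1..n} \<and> J \<subseteq> {1..n} \<and> I \<inter> J = {} \<and> consecutive I \<longrightarrow>
        commute_elementwise G (GI I) (GI J))"

definition weakly_commuting ::
  "nat \<Rightarrow> ('a, 'b) monoid_scheme \<Rightarrow> (nat set \<Rightarrow> 'a set) \<Rightarrow> bool" where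
  "weakly_commuting n G GI \<longleftrightarrow>
     (\<forall>I J. I \<subseteq> {1..n} \<and> J \<subseteq> {1..n} \<and> I \<inter> J = {} \<longrightarrow>
        (\<exists>g\<in>carrier G.
           commute_elementwise G ((\<lambda>x. inv\<^bsub>G\<^esub> g \<otimes>\<^bsub>G\<^esub> x \<otimes>\<^bsub>G\<^esub> g) ` GI I) (GI J)))"


section \<open>The special linear group over the integers\<close>

definition SL_int :: "nat \<Rightarrow> int mat monoid" where
  "SL_int n = \<lparr>carrier = {A \<in> carrier_mat n n. det A = 1}, monoid.mult = (*), one = 1\<^sub>m n\<rparr>"

text \<open>Matrix entries are indexed from 0, whereas the basis vectors \<open>e\<^sub>1, \<dots>, e\<^sub>n\<close> are
  indexed from 1: \<open>e\<^sub>i\<close> is \<open>unit_vec n (i - 1)\<close>. Matrices act on column vectors.\<close>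

definition E_mat :: "nat \<Rightarrow> nat \<Rightarrow> nat \<Rightarrow> int mat" where
  "E_mat n i j = mat n n (\<lambda>(r, c). if r = c \<or> (r = i - 1 \<and> c = j - 1) then 1 else 0)"

definition F_mat :: "nat \<Rightarrow> nat \<Rightarrow> nat \<Rightarrow> int mat" where
  "F_mat n i j = mat n n (\<lambda>(r, c).
     if c = i - 1 then (if r = j - 1 then -1 else 0)
     else if c = j - 1 then (if r = i - 1 then 1 else 0)
     else (if r = c then 1 else 0))"

lemma mat_mult_unit_vec:
  fixes f :: "nat \<times> nat \<Rightarrow> int"
  assumes "k < n"
  shows "mat n n f *\<^sub>v unit_vec n k = vec n (\<lambda>r. f (r, k))"
  using assms by (intro eq_vecI) auto

lemma E_mat_basis:
  assumes "i \<in> {1..n}" "j \<in> {1..n}" "i \<noteq> j" "k \<in> {1..n}"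
  shows "E_mat n i j *\<^sub>v unit_vec n (k - 1) =
    (if k = j then unit_vec n (j - 1) + unit_vec n (i - 1) else unit_vec n (k - 1))"
  unfolding E_mat_def using assms
  by (subst mat_mult_unit_vec) (auto simp: unit_vec_def intro!: eq_vecI)

lemma F_mat_basis:
  assumes "i \<in> {1..n}" "j \<in> {1..n}" "i \<noteq> j" "k \<in> {1..n}"
  shows "F_mat n i j *\<^sub>v unit_vec n (k - 1) =
    (if k = i then - unit_vec n (j - 1) else if k = j then unit_vec n (i - 1)
     else unit_vec n (k - 1))"
  unfolding F_mat_def using assms
  by (subst mat_mult_unit_vec) (auto simp: unit_vec_def intro!: eq_vecI)

lemma SL_int_group: "group (SL_int n)"
proof (rule groupI)
  fix A assume "A \<in> carrier (SL_int n)"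
  then have A: "A \<in> carrier_mat n n" "det A = 1"
    by (auto simp: SL_int_def)
  note adj = adj_mat[OF A(1)]
  have AB: "adj_mat A * A = 1\<^sub>m n"
    using adj(3) A(2) by (auto intro!: eq_matI)
  have "det (adj_mat A) * det A = 1"
    using det_mult[OF adj(1) A(1)] AB by simp
  then have "adj_mat A \<in> carrier (SL_int n)"
    using A adj(1) by (simp add: SL_int_def)
  then show "\<exists>B\<in>carrier (SL_int n). B \<otimes>\<^bsub>SL_int n\<^esub> A = \<one>\<^bsub>SL_int n\<^esub>"
    using AB by (auto simp: SL_int_def)
qed (auto simp: SL_int_def det_mult)


section \<open>Regular modules\<close>

text \<open>Abelian groups are written multiplicatively, so the sum of a family of subgroups is the
  subgroup generated by their union.\<close>

definition subgroup_sum :: "('v, 'w) monoid_scheme \<Rightarrow> (nat set \<Rightarrow> 'v set) \<Rightarrow> nat set set \<Rightarrow> 'v set" where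
  "subgroup_sum V VI \<I> = generate V (\<Union>I\<in>\<I>. VI I)"

definition n_grading :: "nat \<Rightarrow> ('v, 'w) monoid_scheme \<Rightarrow> (nat set \<Rightarrow> 'v set) \<Rightarrow> bool" where
  "n_grading n V VI \<longleftrightarrow>
     comm_group V \<and>
     (\<forall>I. I \<subseteq> {1..n} \<longrightarrow> subgroup (VI I) V) \<and>
     subgroup_sum V VI {I. I \<subseteq> {1..n}} = carrier V"

text \<open>The minimum is over the natural numbers, so the zero grading has degree 0.\<close>

definition grading_degree :: "nat \<Rightarrow> ('v, 'w) monoid_scheme \<Rightarrow> (nat set \<Rightarrow> 'v set) \<Rightarrow> nat" where
  "grading_degree n V VI =
     (LEAST k. \<forall>I. I \<subseteq> {1..n} \<and> card I > k \<longrightarrow> VI I = {\<one>\<^bsub>V\<^esub>})"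

definition SL_module ::
  "nat \<Rightarrow> ('v, 'w) monoid_scheme \<Rightarrow> (int mat \<Rightarrow> 'v \<Rightarrow> 'v) \<Rightarrow> bool" where
  "SL_module n V act \<longleftrightarrow>
     comm_group V \<and>
     (\<forall>g\<in>carrier (SL_int n). act g \<in> hom V V) \<and>
     (\<forall>v\<in>carrier V. act \<one>\<^bsub>SL_int n\<^esub> v = v) \<and>
     (\<forall>g\<in>carrier (SL_int n). \<forall>h\<in>carrier (SL_int n). \<forall>v\<in>carrier V.
        act (g \<otimes>\<^bsub>SL_int n\<^esub> h) v = act g (act h v))"

definition regular_module ::
  "nat \<Rightarrow> ('v, 'w) monoid_scheme \<Rightarrow> (int mat \<Rightarrow> 'v \<Rightarrow> 'v) \<Rightarrow> (nat set \<Rightarrow> 'v set) \<Rightarrow> bool" where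
  "regular_module n V act VI \<longleftrightarrow>
     SL_module n V act \<and> n_grading n V VI \<and>
     (\<forall>I i j. I \<subseteq> {1..n} \<and> i \<in> {1..n} \<and> j \<in> {1..n} \<and> i \<noteq> j \<and> I \<inter> {i, j} = {} \<longrightarrow>
        (\<forall>v\<in>VI I. act (E_mat n i j) v = v)) \<and>
     (\<forall>I i j. I \<subseteq> {1..n} \<and> i \<in> I \<and> j \<in> {1..n} - I \<longrightarrow>
        (\<forall>g\<in>{E_mat n i j, inv\<^bsub>SL_int n\<^esub> (E_mat n i j), E_mat n j i, inv\<^bsub>SL_int n\<^esub> (E_mat n j i)}.
           \<forall>v\<in>VI I. act g v \<otimes>\<^bsub>V\<^esub> inv\<^bsub>V\<^esub> v \<in> subgroup_sum V VI {(I \<union> {j}) - {i}, I \<union> {j}})) \<and>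
     (\<forall>I i j. I \<subseteq> {1..n} \<and> i \<in> {1..n} \<and> j \<in> {1..n} \<and> i \<noteq> j \<longrightarrow>
        act (F_mat n i j) ` VI I = VI (Transposition.transpose i j ` I))"


section \<open>The abelianization and the induced action\<close>

definition abelianization :: "('a, 'b) monoid_scheme \<Rightarrow> 'a set monoid" where
  "abelianization G = G Mod derived G (carrier G)"

definition ab_class :: "('a, 'b) monoid_scheme \<Rightarrow> 'a \<Rightarrow> 'a set" where
  "ab_class G x = derived G (carrier G) #>\<^bsub>G\<^esub> x"

text \<open>Here \<open>H\<close> is a normal subgroup of \<open>\<Gamma>\<close> and \<open>\<phi>\<close> takes values in \<open>\<Gamma> Mod H\<close>; the lifts of
  \<open>\<phi> g\<close> to \<open>\<Gamma>\<close> are precisely the elements of the coset \<open>\<phi> g\<close>. The lemma \<open>ab_action_class\<close>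
  below shows that the choices do not matter.\<close>

definition ab_action ::
  "('a, 'b) monoid_scheme \<Rightarrow> 'a set \<Rightarrow> ('s \<Rightarrow> 'a set) \<Rightarrow> 's \<Rightarrow> 'a set \<Rightarrow> 'a set" where
  "ab_action \<Gamma> H \<phi> g X =
     (let c = (SOME c. c \<in> \<phi> g); x = (SOME x. x \<in> X)
      in ab_class (\<Gamma>\<lparr>carrier := H\<rparr>) (c \<otimes>\<^bsub>\<Gamma>\<^esub> x \<otimes>\<^bsub>\<Gamma>\<^esub> inv\<^bsub>\<Gamma>\<^esub> c))"

lemma ab_class_absorb:
  assumes "group G" "e \<in> derived G (carrier G)" "y \<in> carrier G"
  shows "ab_class G (e \<otimes>\<^bsub>G\<^esub> y) = ab_class G y"
proof -
  interpret group G by fact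
  have D: "subgroup (derived G (carrier G)) G"
    by (rule derived_is_subgroup) simp
  have e: "e \<in> carrier G"
    using subgroup.mem_carrier[OF D assms(2)] .
  show ?thesis
    unfolding ab_class_def
    using coset_mult_assoc[OF subgroup.subset[OF D] e assms(3)]
      coset_join2[OF e D assms(2)] by simp
qed

lemma ab_action_class:
  assumes "H \<lhd> \<Gamma>" "\<phi> g \<in> carrier (\<Gamma> Mod H)" "c \<in> \<phi> g" "x \<in> H"
  shows "ab_action \<Gamma> H \<phi> g (ab_class (\<Gamma>\<lparr>carrier := H\<rparr>) x) =
    ab_class (\<Gamma>\<lparr>carrier := H\<rparr>) (c \<otimes>\<^bsub>\<Gamma>\<^esub> x \<otimes>\<^bsub>\<Gamma>\<^esub> inv\<^bsub>\<Gamma>\<^esub> c)"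
proof -
  interpret N: normal H \<Gamma> by fact
  define G where "G = \<Gamma>\<lparr>carrier := H\<rparr>"
  have G: "group G"
    unfolding G_def by (rule N.subgroup_imp_group[OF N.subgroup_axioms])
  define D where "D = derived G (carrier G)"
  have D_eq: "D = derived \<Gamma> H"
    unfolding D_def G_def using N.derived_consistent[OF _ N.subgroup_axioms] by simp
  interpret D: normal D \<Gamma>
    unfolding D_eq by (rule N.derived_is_normal[OF assms(1)])
  have DH: "D \<subseteq> H"
    unfolding D_eq by (rule N.derived_incl[OF _ N.subgroup_axioms]) simp
  have cl: "ab_class G y = D #>\<^bsub>\<Gamma>\<^esub> y" for y
    by (simp add: ab_class_def D_def G_def r_coset_def)
  define c0 where "c0 = (SOME c. c \<in> \<phi> g)"
  have c0: "c0 \<in> \<phi> g"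
    unfolding c0_def using assms(3) by (rule someI)
  define x0 where "x0 = (SOME z. z \<in> ab_class G x)"
  have xG: "x \<in> carrier \<Gamma>" using assms(4) by simp
  have "x \<in> ab_class G x"
    unfolding cl using N.rcos_self[OF xG D.subgroup_axioms] .
  then have "x0 \<in> ab_class G x"
    unfolding x0_def by (rule someI)
  then obtain d where d: "d \<in> D" "x0 = d \<otimes>\<^bsub>\<Gamma>\<^esub> x"
    unfolding cl r_coset_def by auto
  obtain a where a: "a \<in> carrier \<Gamma>" "\<phi> g = H #>\<^bsub>\<Gamma>\<^esub> a"
    using assms(2) by (auto simp: FactGroup_def RCOSETS_def)
  obtain h1 where h1: "h1 \<in> H" "c = h1 \<otimes>\<^bsub>\<Gamma>\<^esub> a"
    using assms(3) a by (auto simp: r_coset_def)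
  obtain h2 where h2: "h2 \<in> H" "c0 = h2 \<otimes>\<^bsub>\<Gamma>\<^esub> a"
    using c0 a by (auto simp: r_coset_def)
  have cG: "c \<in> carrier \<Gamma>" using h1 a by simp
  define h where "h = h2 \<otimes>\<^bsub>\<Gamma>\<^esub> inv\<^bsub>\<Gamma>\<^esub> h1"
  have h: "h \<in> H" "c0 = h \<otimes>\<^bsub>\<Gamma>\<^esub> c"
    using h1 h2 a by (auto simp: h_def N.m_assoc N.inv_solve_left N.l_inv N.r_inv
        N.m_assoc[symmetric, of "inv\<^bsub>\<Gamma>\<^esub> h1" h1 a])
  define y where "y = c \<otimes>\<^bsub>\<Gamma>\<^esub> x \<otimes>\<^bsub>\<Gamma>\<^esub> inv\<^bsub>\<Gamma>\<^esub> c"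
  define d' where "d' = c \<otimes>\<^bsub>\<Gamma>\<^esub> d \<otimes>\<^bsub>\<Gamma>\<^esub> inv\<^bsub>\<Gamma>\<^esub> c"
  have y: "y \<in> H" unfolding y_def by (rule N.inv_op_closed2[OF cG assms(4)])
  have d': "d' \<in> D" unfolding d'_def by (rule D.inv_op_closed2[OF cG d(1)])
  have hG: "h \<in> carrier \<Gamma>" and yG: "y \<in> carrier \<Gamma>" and dG: "d \<in> carrier \<Gamma>"
    and d'G: "d' \<in> carrier \<Gamma>"
    using h y d d' by auto
  define e where "e = (h \<otimes>\<^bsub>\<Gamma>\<^esub> d' \<otimes>\<^bsub>\<Gamma>\<^esub> inv\<^bsub>\<Gamma>\<^esub> h) \<otimes>\<^bsub>\<Gamma>\<^esub>
    (h \<otimes>\<^bsub>\<Gamma>\<^esub> y \<otimes>\<^bsub>\<Gamma>\<^esub> inv\<^bsub>\<Gamma>\<^esub> h \<otimes>\<^bsub>\<Gamma>\<^esub> inv\<^bsub>\<Gamma>\<^esub> y)"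
  have "h \<otimes>\<^bsub>\<Gamma>\<^esub> y \<otimes>\<^bsub>\<Gamma>\<^esub> inv\<^bsub>\<Gamma>\<^esub> h \<otimes>\<^bsub>\<Gamma>\<^esub> inv\<^bsub>\<Gamma>\<^esub> y \<in> D"
    unfolding D_eq derived_def using h(1) y by (auto intro!: generate.incl)
  then have e: "e \<in> D"
    unfolding e_def using D.inv_op_closed2[OF hG d'] by blast
  have cancel: "inv\<^bsub>\<Gamma>\<^esub> u \<otimes>\<^bsub>\<Gamma>\<^esub> (u \<otimes>\<^bsub>\<Gamma>\<^esub> v) = v" if "u \<in> carrier \<Gamma>" "v \<in> carrier \<Gamma>" for u v
    using that by (simp add: N.m_assoc[symmetric])
  have "c0 \<otimes>\<^bsub>\<Gamma>\<^esub> x0 \<otimes>\<^bsub>\<Gamma>\<^esub> inv\<^bsub>\<Gamma>\<^esub> c0 = h \<otimes>\<^bsub>\<Gamma>\<^esub> (d' \<otimes>\<^bsub>\<Gamma>\<^esub> y) \<otimes>\<^bsub>\<Gamma>\<^esub> inv\<^bsub>\<Gamma>\<^esub> h"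
    unfolding h(2) d(2) d'_def y_def using hG cG dG xG
    by (simp add: N.m_assoc N.inv_mult_group cancel)
  also have "\<dots> = e \<otimes>\<^bsub>\<Gamma>\<^esub> y"
    unfolding e_def using hG d'G yG by (simp add: N.m_assoc cancel)
  finally have "c0 \<otimes>\<^bsub>\<Gamma>\<^esub> x0 \<otimes>\<^bsub>\<Gamma>\<^esub> inv\<^bsub>\<Gamma>\<^esub> c0 = e \<otimes>\<^bsub>G\<^esub> y"
    by (simp add: G_def)
  then show ?thesis
    using ab_class_absorb[OF G, of e y] e y
    by (simp add: ab_action_def Let_def D_def y_def G_def c0_def x0_def)
qed


section \<open>Centralizing generating sequences\<close>

definition C_rho :: "('a, 'b) monoid_scheme \<Rightarrow> ('c, 'd) monoid_scheme \<Rightarrow> ('a \<Rightarrow> 'c) \<Rightarrow> 'a set" where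
  "C_rho G K \<rho> = {g \<in> carrier G. \<rho> g \<noteq> \<one>\<^bsub>K\<^esub> \<and>
     (\<forall>z\<in>\<rho> ` carrier G. \<rho> g \<otimes>\<^bsub>K\<^esub> z = z \<otimes>\<^bsub>K\<^esub> \<rho> g)}"

text \<open>Lists are indexed from 0: \<open>g\<^sub>i\<close> is \<open>gs ! (i - 1)\<close>, and \<open>take i gs\<close> is
  \<open>g\<^sub>1, \<dots>, g\<^sub>i\<close>, the elements strictly before position \<open>i\<close>.\<close>

definition rho_centralizing ::
  "('a, 'b) monoid_scheme \<Rightarrow> ('c, 'd) monoid_scheme \<Rightarrow> ('a \<Rightarrow> 'c) \<Rightarrow> 'a list \<Rightarrow> bool" where
  "rho_centralizing G K \<rho> gs \<longleftrightarrow>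
     gs \<noteq> [] \<and> set gs \<subseteq> carrier G \<and> gs ! 0 \<in> C_rho G K \<rho> \<and>
     (\<forall>i. 1 \<le> i \<and> i < length gs \<longrightarrow>
        (\<exists>j<i. gs ! j \<in> C_rho G K \<rho> \<and>
           commutator G (gs ! i) (gs ! j) \<in> generate G (set (take i gs))))"

definition rho_CG ::
  "('a, 'b) monoid_scheme \<Rightarrow> ('c, 'd) monoid_scheme \<Rightarrow> ('a \<Rightarrow> 'c) \<Rightarrow> 'a list \<Rightarrow> bool" where
  "rho_CG G K \<rho> gs \<longleftrightarrow> rho_centralizing G K \<rho> gs \<and> generate G (set gs) = carrier G"

end

theory Submission
  imports Defs
begin

text \<open>
  Let \<open>c\<close> be maximal with \<open>\<rho>(\<gamma>\<^sub>c G) \<noteq> 1\<close>, so that \<open>\<rho>\<close> maps \<open>\<gamma>\<^sub>c G\<close> to the centre of \<open>\<rho>(G)\<close>. The quotient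
  \<open>\<gamma>\<^sub>c G / \<gamma>\<^sub>c\<^sub>+\<^sub>1 G\<close> is spanned by \<open>c\<close>-fold commutators of elements of the graded pieces of \<open>L(1)\<close>, which
  makes it a regular module of degree at most \<open>k\<close>, where \<open>k = c d\<close>, or \<open>k = c (d - 1) + 1\<close> if \<open>G\<close> is weakly
  commuting. Since \<open>F\<^sub>i\<^sub>j = E\<^sub>i\<^sub>j E\<^sub>j\<^sub>i\<^sup>-\<^sup>1 E\<^sub>i\<^sub>j\<close>, a character that does not vanish on one graded piece of maximal
  degree can be moved by elementary matrices to one that vanishes on none of finitely many pieces with
  disjoint supports. As \<open>n \<ge> (d + 1) k\<close>, there are \<open>d + 1\<close> disjoint intervals \<open>B\<^sub>0, \<dots>, B\<^sub>d\<close> of length \<open>k\<close>,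
  and after composing \<open>\<rho>\<close> with an automorphism of \<open>G\<close> every \<open>G\<^bsub>B\<^sub>t\<^esub>\<close> contains an element \<open>x\<^sub>t\<close> of
  \<open>C\<^sub>\<rho>(G)\<close>. These elements commute, and a set \<open>J\<close> of size \<open>d\<close> misses some \<open>B\<^sub>t\<close>, so that \<open>G\<^sub>J\<close> commutes with
  \<open>x\<^sub>t\<close>; hence \<open>x\<^sub>0, \<dots>, x\<^sub>d\<close> followed by generators of \<open>G\<close> taken from the subgroups \<open>G\<^sub>J\<close> is a
  \<open>\<rho>\<close>-CG sequence.
\<close>

section \<open>Commutators and characters of the lower central series\<close>

declare lower_central.simps(2) [simp del]

lemma lower_central_one [simp]: "lower_central G (Suc 0) = carrier G"
  by (simp add: lower_central.simps(2))

lemma lower_central_Suc: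
  "lower_central G (Suc (Suc k)) =
    generate G {commutator G x y | x y. x \<in> lower_central G (Suc k) \<and> y \<in> carrier G}"
  by (simp add: lower_central.simps(2)[of G "Suc k"] commutator_subgroup_def)

section \<open>Commutator identities\<close>

context group
begin

lemma inv_cancel [simp]:
  assumes "x \<in> carrier G" "y \<in> carrier G"
  shows "inv x \<otimes> (x \<otimes> y) = y" "x \<otimes> (inv x \<otimes> y) = y"
  using assms by (simp_all add: m_assoc[symmetric])

lemma commutator_closed [simp, intro]:
  "x \<in> carrier G \<Longrightarrow> y \<in> carrier G \<Longrightarrow> commutator G x y \<in> carrier G"
  by (simp add: commutator_def)

lemma commutator_mult_left:
  assumes "x \<in> carrier G" "y \<in> carrier G" "z \<in> carrier G"
  shows "commutator G (x \<otimes> y) z = inv y \<otimes> commutator G x z \<otimes> y \<otimes> commutator G y z"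
  using assms by (simp add: commutator_def m_assoc inv_mult_group)

lemma commutator_mult_right:
  assumes "x \<in> carrier G" "y \<in> carrier G" "z \<in> carrier G"
  shows "commutator G x (y \<otimes> z) = commutator G x z \<otimes> (inv z \<otimes> commutator G x y \<otimes> z)"
  using assms by (simp add: commutator_def m_assoc inv_mult_group)

lemma conj_eq_mult_commutator:
  assumes "x \<in> carrier G" "g \<in> carrier G"
  shows "inv g \<otimes> x \<otimes> g = x \<otimes> commutator G x g"
  using assms by (simp add: commutator_def m_assoc)

lemma mult_eq_mult_commutator:
  assumes "x \<in> carrier G" "y \<in> carrier G"
  shows "x \<otimes> y = y \<otimes> x \<otimes> commutator G x y"
  using assms by (simp add: commutator_def m_assoc)

lemma commutator_eq_one:
  assumes "x \<in> carrier G" "y \<in> carrier G" "x \<otimes> y = y \<otimes> x"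
  shows "commutator G x y = \<one>"
  using assms by (simp add: commutator_def m_assoc)

lemma hom_commutator:
  assumes "group K" "h \<in> hom G K" "x \<in> carrier G" "y \<in> carrier G"
  shows "h (commutator G x y) = commutator K (h x) (h y)"
proof -
  interpret h: group_hom G K h
    using assms by (simp add: group_hom_def group_hom_axioms_def)
  show ?thesis using assms by (simp add: commutator_def)
qed

section \<open>Terms of the lower central series\<close>

lemma lower_central_subgroup: "subgroup (lower_central G (Suc k)) G"
proof (induction k)
  case 0
  then show ?case by (simp add: subgroup_self)
next
  case (Suc k)
  have "{commutator G x y | x y. x \<in> lower_central G (Suc k) \<and> y \<in> carrier G} \<subseteq> carrier G"
    using subgroup.subset[OF Suc] by blast
  then show ?case
    using generate_is_subgroup by (simp add: lower_central_Suc[of G])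
qed

lemma lower_central_closed: "x \<in> lower_central G (Suc k) \<Longrightarrow> x \<in> carrier G"
  using subgroup.mem_carrier[OF lower_central_subgroup] .

lemma commutator_in_lower_central:
  "x \<in> lower_central G (Suc k) \<Longrightarrow> y \<in> carrier G \<Longrightarrow> commutator G x y \<in> lower_central G (Suc (Suc k))"
  unfolding lower_central_Suc by (rule generate.incl) blast

lemma lower_central_induct [consumes 1, case_names comm one mult inv]:
  assumes "u \<in> lower_central G (Suc (Suc k))"
    and "\<And>x y. x \<in> lower_central G (Suc k) \<Longrightarrow> y \<in> carrier G \<Longrightarrow> P (commutator G x y)"
    and "P \<one>"
    and "\<And>x y. x \<in> lower_central G (Suc (Suc k)) \<Longrightarrow> y \<in> lower_central G (Suc (Suc k))
      \<Longrightarrow> P x \<Longrightarrow> P y \<Longrightarrow> P (x \<otimes> y)"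
    and "\<And>x. x \<in> lower_central G (Suc (Suc k)) \<Longrightarrow> P x \<Longrightarrow> P (inv x)"
  shows "P u"
proof -
  define C where "C = {commutator G x y | x y. x \<in> lower_central G (Suc k) \<and> y \<in> carrier G}"
  have C: "lower_central G (Suc (Suc k)) = generate G C"
    by (simp add: lower_central_Suc C_def)
  have "u \<in> generate G C" using assms(1) C by simp
  then show ?thesis
  proof (induction u rule: generate.induct)
    case one
    then show ?case by (rule assms(3))
  next
    case (incl h)
    then show ?case using assms(2) by (auto simp: C_def)
  next
    case (inv h)
    then show ?case
      using assms(2) assms(5)[of h] generate.incl[OF inv] C by (auto simp: C_def)
  next
    case (eng h1 h2)
    then show ?case using assms(4) C by simp
  qed
qed

lemma lower_central_antimono_Suc: "lower_central G (Suc (Suc k)) \<subseteq> lower_central G (Suc k)"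
proof (induction k)
  case 0
  show ?case using lower_central_closed[of _ "Suc 0"] by auto
next
  case (Suc k)
  have "{commutator G x y |x y. x \<in> lower_central G (Suc (Suc k)) \<and> y \<in> carrier G} \<subseteq>
     {commutator G x y |x y. x \<in> lower_central G (Suc k) \<and> y \<in> carrier G}"
    using Suc by blast
  then show ?case
    using mono_generate by (simp add: lower_central_Suc)
qed

lemma lower_central_iso:
  assumes "\<alpha> \<in> iso G G" "x \<in> lower_central G (Suc k)"
  shows "\<alpha> x \<in> lower_central G (Suc k)"
  using assms(2)
proof (induction k arbitrary: x)
  case 0
  then show ?case using assms(1) by (auto simp: iso_def hom_def)
next
  case (Suc k)
  interpret \<alpha>: group_hom G G \<alpha>
    using assms(1) by unfold_locales (simp add: iso_def)
  note sub = lower_central_subgroup[of "Suc k"]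
  show ?case using Suc.prems
  proof (induction rule: lower_central_induct)
    case (comm x y)
    then show ?case
      using Suc.IH[OF comm(1)] lower_central_closed
      by (simp add: hom_commutator[OF group_axioms \<alpha>.homh] commutator_in_lower_central)
  next
    case one
    then show ?case using subgroup.one_closed[OF sub] by simp
  next
    case (mult x y)
    then show ?case
      using subgroup.m_closed[OF sub] lower_central_closed by simp
  next
    case (inv x)
    then show ?case
      using subgroup.m_inv_closed[OF sub] lower_central_closed by simp
  qed
qed

lemma derived_subset_lower_central: "derived G (carrier G) \<subseteq> lower_central G (Suc (Suc 0))"
proof -
  \<comment> \<open>The derived subgroup is built from \<open>h1 h2 h1^-1 h2^-1\<close>, the
    opposite convention, so \<open>commutator\<close> is taken at the inverses.\<close>
  have "h1 \<otimes> h2 \<otimes> inv h1 \<otimes> inv h2 \<in> lower_central G (Suc (Suc 0))"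
    if "h1 \<in> carrier G" "h2 \<in> carrier G" for h1 h2
    using commutator_in_lower_central[of "inv h1" 0 "inv h2"] that by (simp add: commutator_def)
  then show ?thesis
    unfolding derived_def
    by (intro generate_subgroup_incl lower_central_subgroup) auto
qed

section \<open>Finite generation\<close>

lemma generate_finite_support:
  assumes "x \<in> generate G A"
  shows "\<exists>X. finite X \<and> X \<subseteq> A \<and> x \<in> generate G X"
  using assms
proof (induction rule: generate.induct)
  case one
  show ?case using generate.one by blast
next
  case (incl h)
  then show ?case by (intro exI[of _ "{h}"]) (auto intro: generate.incl)
next
  case (inv h)
  then show ?case by (intro exI[of _ "{h}"]) (auto intro: generate.inv)
next
  case (eng h1 h2)
  then obtain X Y where "finite X" "X \<subseteq> A" "h1 \<in> generate G X"
    "finite Y" "Y \<subseteq> A" "h2 \<in> generate G Y" by blast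
  then show ?case
    using mono_generate[of X "X \<union> Y"] mono_generate[of Y "X \<union> Y"]
    by (intro exI[of _ "X \<union> Y"]) (auto intro: generate.eng)
qed

text \<open>Each of finitely many generators is a word in finitely many elements of
  \<open>A\<close>. This will allow generators of \<open>G\<close> to be picked inside the subgroups
  of degree \<open>d\<close>.\<close>

lemma finitely_generated_finite_subset:
  assumes "finitely_generated G" "A \<subseteq> carrier G" "generate G A = carrier G"
  shows "\<exists>X. finite X \<and> X \<subseteq> A \<and> generate G X = carrier G"
proof -
  obtain S where S: "finite S" "S \<subseteq> carrier G" "generate G S = carrier G"
    using assms(1) by (auto simp: finitely_generated_def)
  have "\<forall>s\<in>S. \<exists>X. finite X \<and> X \<subseteq> A \<and> s \<in> generate G X"
    using generate_finite_support S(2) assms(3) by blast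
  then obtain X where X: "\<And>s. s \<in> S \<Longrightarrow> finite (X s) \<and> X s \<subseteq> A \<and> s \<in> generate G (X s)"
    by metis
  let ?Y = "\<Union>s\<in>S. X s"
  have Y: "?Y \<subseteq> carrier G" using X assms(2) by blast
  have "S \<subseteq> generate G ?Y"
    using X mono_generate[of "X _" ?Y] by blast
  then have "carrier G \<subseteq> generate G ?Y"
    using generate_subgroup_incl[OF _ generate_is_subgroup[OF Y]] S(3) by blast
  then have "generate G ?Y = carrier G"
    using generate_incl[OF Y] by blast
  then show ?thesis using X S(1) by (intro exI[of _ ?Y]) auto
qed

end

section \<open>Characters of the factors of the lower central series\<close>

locale two_groups = G: group G + K: group K
  for G :: "('a, 'b) monoid_scheme" (structure) and K :: "('c, 'd) monoid_scheme"
begin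

text \<open>These are the homomorphisms to \<open>K\<close> from the factor of two consecutive
  terms, with the index shifted by one. Graded pieces of the factor are handled through the values
  of such maps, so that no quotient has to be formed.\<close>

definition characters :: "nat \<Rightarrow> ('a \<Rightarrow> 'c) set" where
  "characters c = {f.
     (\<forall>x\<in>lower_central G (Suc c). f x \<in> carrier K) \<and>
     (\<forall>x\<in>lower_central G (Suc c). \<forall>y\<in>lower_central G (Suc c). f (x \<otimes> y) = f x \<otimes>\<^bsub>K\<^esub> f y) \<and>
     (\<forall>x\<in>lower_central G (Suc (Suc c)). f x = \<one>\<^bsub>K\<^esub>)}"

lemma charactersI:
  assumes "\<And>x. x \<in> lower_central G (Suc c) \<Longrightarrow> f x \<in> carrier K"
    and "\<And>x y. x \<in> lower_central G (Suc c) \<Longrightarrow> y \<in> lower_central G (Suc c) \<Longrightarrow> f (x \<otimes> y) = f x \<otimes>\<^bsub>K\<^esub> f y"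
    and "\<And>x. x \<in> lower_central G (Suc (Suc c)) \<Longrightarrow> f x = \<one>\<^bsub>K\<^esub>"
  shows "f \<in> characters c"
  using assms unfolding characters_def by blast

context
  fixes c f
  assumes f: "f \<in> characters c"
begin

lemma char_closed: "x \<in> lower_central G (Suc c) \<Longrightarrow> f x \<in> carrier K"
  and char_mult: "x \<in> lower_central G (Suc c) \<Longrightarrow> y \<in> lower_central G (Suc c) \<Longrightarrow> f (x \<otimes> y) = f x \<otimes>\<^bsub>K\<^esub> f y"
  and char_next: "x \<in> lower_central G (Suc (Suc c)) \<Longrightarrow> f x = \<one>\<^bsub>K\<^esub>"
  using f unfolding characters_def by blast+

lemma char_one: "f \<one> = \<one>\<^bsub>K\<^esub>"
  by (rule char_next[OF subgroup.one_closed[OF G.lower_central_subgroup]])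

lemma char_inv:
  assumes "x \<in> lower_central G (Suc c)"
  shows "f (inv x) = inv\<^bsub>K\<^esub> f x"
proof -
  have i: "inv x \<in> lower_central G (Suc c)"
    using subgroup.m_inv_closed[OF G.lower_central_subgroup assms] .
  have "f (inv x) \<otimes>\<^bsub>K\<^esub> f x = \<one>\<^bsub>K\<^esub>"
    using char_mult[OF i assms] char_one G.lower_central_closed[OF assms] by simp
  then show ?thesis
    using K.inv_equality char_closed i assms by metis
qed

text \<open>Conjugation multiplies \<open>x\<close> by \<open>commutator G x g\<close>, which lies
  in the next term and is killed by \<open>f\<close>.\<close>

lemma char_conj:
  assumes "x \<in> lower_central G (Suc c)" "g \<in> carrier G"
  shows "inv g \<otimes> x \<otimes> g \<in> lower_central G (Suc c)" "f (inv g \<otimes> x \<otimes> g) = f x"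
proof -
  note c = G.commutator_in_lower_central[OF assms]
  have c': "commutator G x g \<in> lower_central G (Suc c)"
    using c G.lower_central_antimono_Suc by blast
  note e = G.conj_eq_mult_commutator[OF G.lower_central_closed[OF assms(1)] assms(2)]
  show "inv g \<otimes> x \<otimes> g \<in> lower_central G (Suc c)"
    unfolding e by (rule subgroup.m_closed[OF G.lower_central_subgroup assms(1) c'])
  show "f (inv g \<otimes> x \<otimes> g) = f x"
    unfolding e char_mult[OF assms(1) c'] using char_next[OF c] char_closed[OF assms(1)] by simp
qed

text \<open>The two products differ by a commutator in the next term. Hence the values commute
  although \<open>K\<close> need not be abelian.\<close>

lemma char_comm:
  assumes "x \<in> lower_central G (Suc c)" "y \<in> lower_central G (Suc c)"
  shows "f x \<otimes>\<^bsub>K\<^esub> f y = f y \<otimes>\<^bsub>K\<^esub> f x"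
proof -
  have "y \<in> carrier G" using G.lower_central_closed[OF assms(2)] .
  note c = G.commutator_in_lower_central[OF assms(1) this]
  have c': "commutator G x y \<in> lower_central G (Suc c)"
    using c G.lower_central_antimono_Suc by blast
  have "x \<otimes> y = y \<otimes> x \<otimes> commutator G x y"
    using G.mult_eq_mult_commutator G.lower_central_closed assms by metis
  moreover have "y \<otimes> x \<in> lower_central G (Suc c)"
    using subgroup.m_closed[OF G.lower_central_subgroup] assms by blast
  ultimately show ?thesis
    using char_mult[OF \<open>y \<otimes> x \<in> _\<close> c'] char_mult[OF assms] char_mult[OF assms(2,1)]
      char_next[OF c] char_closed assms by simp
qed

lemma char_iso:
  assumes "\<alpha> \<in> iso G G"
  shows "(\<lambda>x. f (\<alpha> x)) \<in> characters c"
proof (rule charactersI)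
  fix x y assume x: "x \<in> lower_central G (Suc c)" and y: "y \<in> lower_central G (Suc c)"
  have "\<alpha> (x \<otimes> y) = \<alpha> x \<otimes> \<alpha> y"
    using assms G.lower_central_closed x y by (auto simp: iso_def hom_def)
  then show "f (\<alpha> (x \<otimes> y)) = f (\<alpha> x) \<otimes>\<^bsub>K\<^esub> f (\<alpha> y)"
    using char_mult G.lower_central_iso[OF assms] x y by simp
qed (use char_closed char_next G.lower_central_iso[OF assms] in blast)+

end

text \<open>The product rule for \<open>[xy,z]\<close> becomes additivity, since \<open>f\<close>
  ignores conjugation. Together with the analogue for the second entry this makes \<open>f\<close>
  of a commutator a character in each entry separately, which drives all inductions on the number of
  entries.\<close>

lemma char_commutator_left:
  assumes f: "f \<in> characters (Suc c)" and z: "z \<in> carrier G"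
  shows "(\<lambda>x. f (commutator G x z)) \<in> characters c"
proof (rule charactersI)
  fix x assume x: "x \<in> lower_central G (Suc c)"
  note cx = G.commutator_in_lower_central[OF x z]
  show "f (commutator G x z) \<in> carrier K"
    using char_closed[OF f cx] .
  fix y assume y: "y \<in> lower_central G (Suc c)"
  note cy = G.commutator_in_lower_central[OF y z]
  note carr = G.lower_central_closed[OF x] G.lower_central_closed[OF y]
  show "f (commutator G (x \<otimes> y) z) = f (commutator G x z) \<otimes>\<^bsub>K\<^esub> f (commutator G y z)"
    unfolding G.commutator_mult_left[OF carr z]
    using char_mult[OF f char_conj(1)[OF f cx carr(2)] cy] char_conj(2)[OF f cx carr(2)] by simp
next
  fix x assume "x \<in> lower_central G (Suc (Suc c))"
  then show "f (commutator G x z) = \<one>\<^bsub>K\<^esub>"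
    using char_next[OF f] G.commutator_in_lower_central z by blast
qed

text \<open>A homomorphism from \<open>G\<close> with commuting values kills the commutators, so the three subgroup
  lemma is not needed for the last condition on characters.\<close>

lemma char_commutator_right:
  assumes f: "f \<in> characters (Suc c)" and y: "y \<in> lower_central G (Suc c)"
  shows "(\<lambda>z. f (commutator G y z)) \<in> characters 0"
proof -
  define h where "h z = f (commutator G y z)" for z
  note yG = G.lower_central_closed[OF y]
  have cl: "commutator G y z \<in> lower_central G (Suc (Suc c))" if "z \<in> carrier G" for z
    using G.commutator_in_lower_central[OF y that] .
  have abel: "h a \<otimes>\<^bsub>K\<^esub> h b = h b \<otimes>\<^bsub>K\<^esub> h a" if "a \<in> carrier G" "b \<in> carrier G" for a b
    unfolding h_def using char_comm[OF f cl cl] that by blast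
  have mult: "h (a \<otimes> b) = h a \<otimes>\<^bsub>K\<^esub> h b" if ab: "a \<in> carrier G" "b \<in> carrier G" for a b
  proof -
    have "h (a \<otimes> b) = h b \<otimes>\<^bsub>K\<^esub> h a"
      unfolding h_def G.commutator_mult_right[OF yG ab]
      using char_mult[OF f cl[OF ab(2)] char_conj(1)[OF f cl[OF ab(1)] ab(2)]]
        char_conj(2)[OF f cl[OF ab(1)] ab(2)] by simp
    then show ?thesis using abel ab by simp
  qed
  have closed: "h a \<in> carrier K" if "a \<in> carrier G" for a
    unfolding h_def using char_closed[OF f cl[OF that]] .
  interpret h: group_hom G K h
    by unfold_locales (auto simp: hom_def mult closed)
  have "h z = \<one>\<^bsub>K\<^esub>" if "z \<in> lower_central G (Suc (Suc 0))" for z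
    using that
  proof (induction rule: G.lower_central_induct)
    case (comm x y)
    then have "x \<in> carrier G" "y \<in> carrier G" by auto
    then show ?case
      by (simp add: G.hom_commutator[OF K.group_axioms h.homh] K.commutator_eq_one abel)
  qed (use G.lower_central_closed in \<open>auto\<close>)
  then have "h \<in> characters 0"
    by (intro charactersI) (auto simp: mult closed)
  then show ?thesis by (simp add: h_def[abs_def])
qed

end

section \<open>Spreading nonvanishing by elementary moves\<close>

lemma transpose_image_exchange:
  assumes "i \<in> I" "j \<notin> I"
  shows "Transposition.transpose i j ` I = insert j (I - {i})"
    and "Transposition.transpose i j ` insert j (I - {i}) = I"
proof -
  show 1: "Transposition.transpose i j ` I = insert j (I - {i})"
    using assms by (auto simp: Transposition.transpose_def image_iff)
  show "Transposition.transpose i j ` insert j (I - {i}) = I"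
    unfolding 1[symmetric] by (simp add: image_comp)
qed

text \<open>A state \<open>s\<close> stands for a character twisted by an automorphism, \<open>nz s I\<close> says that it does not vanish
  on the graded piece of \<open>I\<close>, and \<open>step i j\<close> precomposes with an automorphism inducing
  \<open>E\<^sub>i\<^sub>j\<close>, \<open>E\<^sub>j\<^sub>i\<close> or an inverse. The number \<open>m\<close> is the largest size of a set on which some
  state is nonzero, which is why \<open>step_persistent\<close> does not mention \<open>insert j I\<close>.\<close>

locale spreading =
  fixes n m :: nat
    and S :: "'s set"
    and step :: "nat \<Rightarrow> nat \<Rightarrow> 's \<Rightarrow> 's \<Rightarrow> bool"
    and nz :: "'s \<Rightarrow> nat set \<Rightarrow> bool"
  assumes step_closed:
      "\<lbrakk>i \<in> {1..n}; j \<in> {1..n}; i \<noteq> j; s \<in> S; step i j s s'\<rbrakk> \<Longrightarrow> s' \<in> S"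
    and step_inert:
      "\<lbrakk>i \<in> {1..n}; j \<in> {1..n}; i \<noteq> j; s \<in> S; step i j s s'; I \<subseteq> {1..n}; I \<inter> {i, j} = {}\<rbrakk>
        \<Longrightarrow> nz s' I \<longleftrightarrow> nz s I"
    and step_persistent:
      "\<lbrakk>s \<in> S; step i j s s'; I \<subseteq> {1..n}; card I = m; i \<in> I; j \<in> {1..n} - I;
        nz s I; \<not> nz s (insert j (I - {i}))\<rbrakk> \<Longrightarrow> nz s' I"
    and swap:
      "\<lbrakk>i \<in> {1..n}; j \<in> {1..n}; i \<noteq> j; s \<in> S\<rbrakk> \<Longrightarrow>
        \<exists>s'. (step i j)\<^sup>*\<^sup>* s s' \<and>
          (\<forall>I. I \<subseteq> {1..n} \<longrightarrow> nz s (Transposition.transpose i j ` I) \<longrightarrow> nz s' I)"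
begin

lemma steps_closed:
  assumes "(step i j)\<^sup>*\<^sup>* s s'" "i \<in> {1..n}" "j \<in> {1..n}" "i \<noteq> j" "s \<in> S"
  shows "s' \<in> S"
  using assms by (induction rule: rtranclp_induct) (auto intro: step_closed)

lemma steps_inert:
  assumes "(step i j)\<^sup>*\<^sup>* s s'" "i \<in> {1..n}" "j \<in> {1..n}" "i \<noteq> j" "s \<in> S"
    and "I \<subseteq> {1..n}" "I \<inter> {i, j} = {}"
  shows "nz s' I \<longleftrightarrow> nz s I"
  using assms(1)
proof (induction rule: rtranclp_induct)
  case (step y z)
  then show ?case
    using step_inert[OF assms(2-4) steps_closed[OF step(1) assms(2-5)] step(2) assms(6,7)] by simp
qed simp

text \<open>For a set containing \<open>i\<close> but not \<open>j\<close>, the transposition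
  replaces \<open>i\<close> by \<open>j\<close>. One state \<open>s'\<close> serves all such sets
  \<open>P\<close>, so that two nonzero sets can be moved at once.\<close>

lemma swap_exchange:
  assumes "i \<in> I" "j \<in> {1..n} - I" "I \<subseteq> {1..n}" "s \<in> S"
  shows "\<exists>s'. (step i j)\<^sup>*\<^sup>* s s' \<and>
    (\<forall>P. P \<subseteq> {1..n} \<longrightarrow> i \<in> P \<longrightarrow> j \<notin> P \<longrightarrow>
      (nz s P \<longrightarrow> nz s' (insert j (P - {i}))) \<and> (nz s (insert j (P - {i})) \<longrightarrow> nz s' P))"
proof -
  have ij: "i \<in> {1..n}" "j \<in> {1..n}" "i \<noteq> j" using assms by auto
  obtain s' where s': "(step i j)\<^sup>*\<^sup>* s s'"
    "\<And>I. I \<subseteq> {1..n} \<Longrightarrow> nz s (Transposition.transpose i j ` I) \<Longrightarrow> nz s' I"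
    using swap[OF ij assms(4)] by blast
  have "(nz s P \<longrightarrow> nz s' (insert j (P - {i}))) \<and> (nz s (insert j (P - {i})) \<longrightarrow> nz s' P)"
    if P: "P \<subseteq> {1..n}" "i \<in> P" "j \<notin> P" for P
    using s'(2)[of P] s'(2)[of "insert j (P - {i})"] transpose_image_exchange[OF P(2,3)] P ij
    by auto
  then show ?thesis using s'(1) by blast
qed

text \<open>While both \<open>P\<close> and \<open>Q\<close> are nonzero and both exchanged sets vanish, every step keeps \<open>P\<close>
  and \<open>Q\<close> nonzero. If \<open>P\<close>'s exchanged set becomes nonzero, the swap finishes the proof; and both
  cannot vanish forever, since the swap itself is a sequence of steps.\<close>

lemma exchange_step:
  assumes s: "s \<in> S" "nz s P" "nz s Q"
    and P: "P \<subseteq> {1..n}" "card P = m" "i \<in> P" "j \<notin> P"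
    and Q: "Q \<subseteq> {1..n}" "card Q = m" "i \<in> Q" "j \<notin> Q"
    and j: "j \<in> {1..n}"
  shows "\<exists>s'. (step i j)\<^sup>*\<^sup>* s s' \<and> nz s' P \<and> nz s' (insert j (Q - {i}))"
proof (rule ccontr)
  assume contra: "\<not> ?thesis"
  have ij: "i \<in> {1..n}" "j \<in> {1..n}" "i \<noteq> j" using P j by auto
  have vanish: "\<not> nz t (insert j (P - {i})) \<and> \<not> nz t (insert j (Q - {i}))"
    if t: "(step i j)\<^sup>*\<^sup>* s t" "nz t P" "nz t Q" for t
  proof -
    have tS: "t \<in> S" using steps_closed[OF t(1) ij s(1)] .
    obtain t' where t': "(step i j)\<^sup>*\<^sup>* t t'"
      "nz t (insert j (P - {i})) \<longrightarrow> nz t' P" "nz t' (insert j (Q - {i}))"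
      using swap_exchange[of i P j t] P Q j tS t by blast
    then show ?thesis using contra t rtranclp_trans[OF t(1) t'(1)] by blast
  qed
  have stay: "nz t P \<and> nz t Q" if "(step i j)\<^sup>*\<^sup>* s t" for t
    using that
  proof (induction rule: rtranclp_induct)
    case base
    then show ?case using s by simp
  next
    case (step t u)
    have "t \<in> S" using steps_closed[OF step(1) ij s(1)] .
    then show ?case
      using step_persistent[OF _ step(2)] P Q j step.IH vanish[OF step(1)] by blast
  qed
  obtain t where "(step i j)\<^sup>*\<^sup>* s t" "nz t (insert j (P - {i}))"
    using swap_exchange[of i P j s] P j s by blast
  then show False using stay vanish by blast
qed

text \<open>A copy of \<open>P\<close> is moved into \<open>T\<close> one element at a time by
  \<open>exchange_step\<close>, which keeps \<open>P\<close> itself nonzero. All indices used lie in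
  \<open>P \<union> T\<close>, so sets disjoint from it are not affected.\<close>

lemma spread:
  assumes "s \<in> S" "nz s P"
    and P: "P \<subseteq> {1..n}" "card P = m"
    and T: "T \<subseteq> {1..n}" "card T = m" "P \<inter> T = {}"
  shows "\<exists>s'\<in>S. nz s' P \<and> nz s' T \<and>
    (\<forall>J. J \<subseteq> {1..n} \<longrightarrow> J \<inter> (P \<union> T) = {} \<longrightarrow> (nz s' J \<longleftrightarrow> nz s J))"
proof -
  have fin: "finite A" if "A \<subseteq> {1..n}" for A using that finite_subset by auto
  \<comment> \<open>The travelling copy is \<open>Q\<close>, starting at \<open>P\<close> and ending
    at \<open>T\<close>; the induction is on the number of elements of \<open>T\<close> it still
    lacks.\<close>
  have "\<exists>s'\<in>S. nz s' P \<and> nz s' T \<and>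
    (\<forall>J. J \<subseteq> {1..n} \<longrightarrow> J \<inter> (P \<union> T) = {} \<longrightarrow> (nz s' J \<longleftrightarrow> nz s J))"
    if "s \<in> S" "nz s P" "nz s Q" "Q \<subseteq> P \<union> T" "card Q = m" for s Q
    using that
  proof (induction "card (T - Q)" arbitrary: s Q rule: less_induct)
    case less
    have Qn: "Q \<subseteq> {1..n}" using less.prems(4) P T by blast
    show ?case
    proof (cases "T = Q")
      case True
      then show ?thesis using less.prems by blast
    next
      case False
      have "\<not> T \<subseteq> Q" "\<not> Q \<subseteq> T"
        using card_subset_eq[OF fin[OF Qn], of T] card_subset_eq[OF fin[OF T(1)], of Q]
          False T(2) less.prems(5) by auto
      then obtain i j where i: "i \<in> Q" "i \<notin> T" and j: "j \<in> T" "j \<notin> Q" by blast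
      have iP: "i \<in> P" and jP: "j \<notin> P" using i j less.prems(4) T(3) by auto
      have ij: "i \<in> {1..n}" "j \<in> {1..n}" "i \<noteq> j" using i j Qn T by auto
      obtain t where t: "(step i j)\<^sup>*\<^sup>* s t" "nz t P" "nz t (insert j (Q - {i}))"
        using exchange_step[OF less.prems(1-3) P iP jP Qn less.prems(5) i(1) j(2) ij(2)] by blast
      have tS: "t \<in> S" using steps_closed[OF t(1) ij less.prems(1)] .
      have "T - insert j (Q - {i}) \<subset> T - Q" using i j by auto
      then have lt: "card (T - insert j (Q - {i})) < card (T - Q)"
        using fin[OF T(1)] by (intro psubset_card_mono) auto
      have "card (insert j (Q - {i})) = m"
        using less.prems(5) i j fin[OF Qn] card_Suc_Diff1[of Q i] by simp
      moreover have "insert j (Q - {i}) \<subseteq> P \<union> T" using j less.prems(4) by auto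
      ultimately obtain s' where s': "s' \<in> S" "nz s' P" "nz s' T"
        "\<And>J. J \<subseteq> {1..n} \<Longrightarrow> J \<inter> (P \<union> T) = {} \<Longrightarrow> nz s' J \<longleftrightarrow> nz t J"
        using less.hyps[OF lt tS t(2,3)] by blast
      have "nz s' J \<longleftrightarrow> nz s J" if J: "J \<subseteq> {1..n}" "J \<inter> (P \<union> T) = {}" for J
      proof -
        have "J \<inter> {i, j} = {}" using J(2) iP j(1) by auto
        then show ?thesis
          using s'(4)[OF J] steps_inert[OF t(1) ij less.prems(1) J(1)] by simp
      qed
      then show ?thesis using s' by blast
    qed
  qed
  from this[OF assms(1,2,2) _ P(2)] show ?thesis by blast
qed

text \<open>Nonvanishing is first known only on some set of size \<open>m\<close>. Swaps alone carry
  it to a prescribed set, as the original set may be given up.\<close>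

lemma relocate:
  assumes "s \<in> S" "nz s Q" "Q \<subseteq> {1..n}" "card Q = m" "T \<subseteq> {1..n}" "card T = m"
  shows "\<exists>s'\<in>S. nz s' T"
  using assms
proof (induction "card (T - Q)" arbitrary: s Q rule: less_induct)
  case less
  have fin: "finite Q" "finite T" using less.prems finite_subset by blast+
  show ?case
  proof (cases "T = Q")
    case True
    then show ?thesis using less.prems by blast
  next
    case False
    have "\<not> T \<subseteq> Q" "\<not> Q \<subseteq> T"
      using card_subset_eq[of Q T] card_subset_eq[of T Q] fin False less.prems by auto
    then obtain i j where i: "i \<in> Q" "i \<notin> T" and j: "j \<in> T" "j \<notin> Q" by blast
    obtain t where t: "(step i j)\<^sup>*\<^sup>* s t" "nz t (insert j (Q - {i}))"
      using swap_exchange[of i Q j s] i j less.prems by blast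
    have tS: "t \<in> S" using steps_closed[OF t(1)] i j less.prems by blast
    have "T - insert j (Q - {i}) \<subset> T - Q" using i j by auto
    then have lt: "card (T - insert j (Q - {i})) < card (T - Q)"
      using fin by (intro psubset_card_mono) auto
    have "card (insert j (Q - {i})) = m"
      using less.prems(4) i j fin card_Suc_Diff1[of Q i] by simp
    moreover have "insert j (Q - {i}) \<subseteq> {1..n}" using less.prems(3,5) j by blast
    ultimately show ?thesis
      using less.hyps[OF lt tS t(2)] less.prems(5,6) by blast
  qed
qed

text \<open>\<open>relocate\<close> reaches \<open>T 0\<close>, and \<open>spread\<close> then
  passes from \<open>T r\<close> to \<open>T (Suc r)\<close>; the earlier sets are disjoint from
  both and keep their status.\<close>

lemma simultaneously_nonzero:
  fixes r :: nat
  assumes "s \<in> S" "nz s Q" "Q \<subseteq> {1..n}" "card Q = m"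
    and T: "\<And>t. t \<le> r \<Longrightarrow> T t \<subseteq> {1..n}" "\<And>t. t \<le> r \<Longrightarrow> card (T t) = m"
    and disj: "\<And>t u. t < u \<Longrightarrow> u \<le> r \<Longrightarrow> T t \<inter> T u = {}"
  shows "\<exists>s'\<in>S. \<forall>t\<le>r. nz s' (T t)"
  using T disj
proof (induction r)
  case 0
  then show ?case using relocate[OF assms(1-4), of "T 0"] by auto
next
  case (Suc r)
  obtain s1 where s1: "s1 \<in> S" "\<forall>t\<le>r. nz s1 (T t)"
    using Suc.IH Suc.prems by (metis le_Suc_eq)
  obtain s2 where s2: "s2 \<in> S" "nz s2 (T r)" "nz s2 (T (Suc r))"
    "\<And>J. J \<subseteq> {1..n} \<Longrightarrow> J \<inter> (T r \<union> T (Suc r)) = {} \<Longrightarrow> nz s2 J \<longleftrightarrow> nz s1 J"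
    using spread[OF s1(1), of "T r" "T (Suc r)"] s1(2) Suc.prems by (metis le_Suc_eq lessI order_refl)
  have "nz s2 (T t)" if "t \<le> Suc r" for t
  proof (cases "t < r")
    case True
    then have "T t \<inter> T r = {}" "T t \<inter> T (Suc r) = {}"
      using Suc.prems(3)[of t r] Suc.prems(3)[of t "Suc r"] by auto
    then show ?thesis
      using s2(4)[of "T t"] Suc.prems(1)[of t] s1(2) True by auto
  next
    case False
    then have "t = r \<or> t = Suc r" using that by auto
    then show ?thesis using s2 by auto
  qed
  then show ?case using s2(1) by blast
qed

end

section \<open>Iterated commutators with supports\<close>

text \<open>\<open>W1 I\<close> is the preimage in \<open>G\<close> of the graded piece \<open>L(1)\<^sup>I\<close>, and \<open>E i j\<close> consists of
  automorphisms of \<open>G\<close> that induce the action of \<open>E\<^sub>i\<^sub>j\<close>, \<open>E\<^sub>j\<^sub>i\<close> or their inverses.\<close>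

locale regular_group = two_groups G K
  for G :: "('a, 'b) monoid_scheme" (structure) and K :: "('c, 'd) monoid_scheme" +
  fixes n d :: nat
    and GI :: "nat set \<Rightarrow> 'a set"
    and W1 :: "nat set \<Rightarrow> 'a set"
    and E :: "nat \<Rightarrow> nat \<Rightarrow> ('a \<Rightarrow> 'a) set"
  assumes n_group: "n_group n G GI"
    and partially_commuting: "partially_commuting n G GI"
    and E_iso: "\<lbrakk>i \<in> {1..n}; j \<in> {1..n}; i \<noteq> j; \<epsilon> \<in> E i j\<rbrakk> \<Longrightarrow> \<epsilon> \<in> iso G G"
    and W1_closed: "I \<subseteq> {1..n} \<Longrightarrow> W1 I \<subseteq> carrier G"
    and W1_generate: "\<lbrakk>f \<in> characters 0; \<And>I x. I \<subseteq> {1..n} \<Longrightarrow> x \<in> W1 I \<Longrightarrow> f x = \<one>\<^bsub>K\<^esub>; x \<in> carrier G\<rbrakk>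
      \<Longrightarrow> f x = \<one>\<^bsub>K\<^esub>"
    and W1_inert: "\<lbrakk>i \<in> {1..n}; j \<in> {1..n}; i \<noteq> j; \<epsilon> \<in> E i j; I \<subseteq> {1..n}; I \<inter> {i, j} = {};
      x \<in> W1 I; f \<in> characters 0\<rbrakk> \<Longrightarrow> f (\<epsilon> x) = f x"
    and W1_exchange: "\<lbrakk>I \<subseteq> {1..n}; i \<in> I; j \<in> {1..n} - I; \<epsilon> \<in> E i j; x \<in> W1 I; f \<in> characters 0;
      \<And>y. y \<in> W1 (insert j (I - {i})) \<union> W1 (insert j I) \<Longrightarrow> f y = \<one>\<^bsub>K\<^esub>\<rbrakk> \<Longrightarrow> f (\<epsilon> x) = f x"
    and W1_swap: "\<lbrakk>i \<in> {1..n}; j \<in> {1..n}; i \<noteq> j\<rbrakk> \<Longrightarrow> \<exists>\<epsilon>\<^sub>1\<in>E i j. \<exists>\<epsilon>\<^sub>2\<in>E i j. \<exists>\<epsilon>\<^sub>3\<in>E i j. \<forall>I. I \<subseteq> {1..n} \<longrightarrow>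
      W1 (Transposition.transpose i j ` I) \<subseteq> (\<lambda>x. \<epsilon>\<^sub>1 (\<epsilon>\<^sub>2 (\<epsilon>\<^sub>3 x))) ` W1 I"
    and W1_lift: "\<lbrakk>I \<subseteq> B; B \<subseteq> {1..n}; d \<le> card B; x \<in> W1 I\<rbrakk>
      \<Longrightarrow> \<exists>x'\<in>GI B. \<forall>f\<in>characters 0. f x' = f x"
    and W1_degree: "\<lbrakk>I \<subseteq> {1..n}; d < card I; x \<in> W1 I; f \<in> characters 0\<rbrakk> \<Longrightarrow> f x = \<one>\<^bsub>K\<^esub>"
begin

text \<open>Left-normed commutators with \<open>c + 1\<close> entries, the index being shifted as
  for \<open>characters\<close>. Supports of entries may overlap; only their union is recorded. Bare
  sets suffice in place of subgroups, because elements are compared by the values of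
  characters.\<close>

primrec W :: "nat \<Rightarrow> nat set \<Rightarrow> 'a set" where
  "W 0 I = W1 I"
| "W (Suc c) I = {commutator G x y | x y. \<exists>A B. A \<union> B = I \<and> x \<in> W c A \<and> y \<in> W1 B}"

lemma W_SucI: "x \<in> W c A \<Longrightarrow> y \<in> W1 B \<Longrightarrow> A \<union> B = I \<Longrightarrow> commutator G x y \<in> W (Suc c) I"
  by auto

lemma W_SucE:
  assumes "x \<in> W (Suc c) I"
  obtains y z A B where "x = commutator G y z" "A \<union> B = I" "y \<in> W c A" "z \<in> W1 B"
  using assms by auto

lemma W_lower_central: "I \<subseteq> {1..n} \<Longrightarrow> x \<in> W c I \<Longrightarrow> x \<in> lower_central G (Suc c)"
proof (induction c arbitrary: I x)
  case 0
  then show ?case using W1_closed by auto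
next
  case (Suc c)
  obtain y z A B where x: "x = commutator G y z" "A \<union> B = I" "y \<in> W c A" "z \<in> W1 B"
    using W_SucE[OF Suc.prems(2)] .
  then have "A \<subseteq> {1..n}" "B \<subseteq> {1..n}" using Suc.prems by auto
  then show ?case
    using x Suc.IH G.commutator_in_lower_central W1_closed by blast
qed

text \<open>Additivity in each entry: \<open>left\<close> treats an arbitrary first entry against a
  second entry from a graded piece, and \<open>kill\<close> then makes the second entry arbitrary as
  well.\<close>

lemma W_generate:
  assumes "f \<in> characters c" "\<And>I x. I \<subseteq> {1..n} \<Longrightarrow> x \<in> W c I \<Longrightarrow> f x = \<one>\<^bsub>K\<^esub>"
    and "x \<in> lower_central G (Suc c)"
  shows "f x = \<one>\<^bsub>K\<^esub>"
  using assms
proof (induction c arbitrary: f x)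
  case 0
  then show ?case using W1_generate[OF 0(1)] by simp
next
  case (Suc c)
  have left: "f (commutator G y z) = \<one>\<^bsub>K\<^esub>"
    if B: "B \<subseteq> {1..n}" "z \<in> W1 B" and y: "y \<in> lower_central G (Suc c)" for y z B
  proof (rule Suc.IH[OF char_commutator_left[OF Suc.prems(1)] _ y])
    show "z \<in> carrier G" using B W1_closed by blast
    fix A y' assume "A \<subseteq> {1..n}" "y' \<in> W c A"
    then show "f (commutator G y' z) = \<one>\<^bsub>K\<^esub>"
      using Suc.prems(2)[of "A \<union> B"] W_SucI[OF _ B(2)] B(1) by blast
  qed
  have kill: "f (commutator G y z) = \<one>\<^bsub>K\<^esub>"
    if y: "y \<in> lower_central G (Suc c)" and z: "z \<in> carrier G" for y z
    using W1_generate[OF char_commutator_right[OF Suc.prems(1) y] _ z] left[OF _ _ y] by blast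
  show ?case using Suc.prems(3)
  proof (induction rule: G.lower_central_induct)
    case (comm y z)
    then show ?case by (rule kill)
  qed (simp_all add: char_one[OF Suc.prems(1)] char_mult[OF Suc.prems(1)] char_inv[OF Suc.prems(1)])
qed

lemma iso_commutator:
  assumes "\<alpha> \<in> iso G G" "x \<in> carrier G" "y \<in> carrier G"
  shows "\<alpha> (commutator G x y) = commutator G (\<alpha> x) (\<alpha> y)"
  using G.hom_commutator[OF G.group_axioms _ assms(2,3)] assms(1) by (simp add: iso_def)

lemma iso_closed: "\<alpha> \<in> iso G G \<Longrightarrow> x \<in> carrier G \<Longrightarrow> \<alpha> x \<in> carrier G"
  by (auto simp: iso_def hom_def)

text \<open>The entries are restored one at a time: \<open>\<epsilon> y\<close> becomes
  \<open>y\<close> against the fixed entry \<open>\<epsilon> z\<close>, then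
  \<open>\<epsilon> z\<close> becomes \<open>z\<close>.\<close>

lemma W_inert:
  assumes ij: "i \<in> {1..n}" "j \<in> {1..n}" "i \<noteq> j" and \<epsilon>: "\<epsilon> \<in> E i j"
    and "I \<subseteq> {1..n}" "I \<inter> {i, j} = {}" "x \<in> W c I" "f \<in> characters c"
  shows "f (\<epsilon> x) = f x"
  using assms(5-8)
proof (induction c arbitrary: f I x)
  case 0
  then show ?case using W1_inert[OF ij \<epsilon>] by auto
next
  case (Suc c)
  note iso = E_iso[OF ij \<epsilon>]
  obtain y z A B where x: "x = commutator G y z" "A \<union> B = I" "y \<in> W c A" "z \<in> W1 B"
    using W_SucE[OF Suc.prems(3)] .
  have A: "A \<subseteq> {1..n}" "A \<inter> {i, j} = {}" and B: "B \<subseteq> {1..n}" "B \<inter> {i, j} = {}"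
    using x(2) Suc.prems(1,2) by auto
  have y: "y \<in> lower_central G (Suc c)" using W_lower_central[OF A(1) x(3)] .
  have yG: "y \<in> carrier G" using G.lower_central_closed[OF y] .
  have z: "z \<in> carrier G" using W1_closed[OF B(1)] x(4) by blast
  have "f (\<epsilon> x) = f (commutator G (\<epsilon> y) (\<epsilon> z))"
    using x(1) iso_commutator[OF iso yG z] by simp
  also have "\<dots> = f (commutator G y (\<epsilon> z))"
    by (rule Suc.IH[OF A x(3) char_commutator_left[OF Suc.prems(4) iso_closed[OF iso z]]])
  also have "\<dots> = f x"
    unfolding x(1) by (rule W1_inert[OF ij \<epsilon> B x(4) char_commutator_right[OF Suc.prems(4) y]])
  finally show ?case .
qed

text \<open>Expanding the commutator of \<open>\<epsilon> y\<close> and \<open>\<epsilon> z\<close>,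
  every correction term has support \<open>insert j (I - {i})\<close> or \<open>insert j I\<close>,
  where \<open>f\<close> vanishes.\<close>

lemma W_exchange:
  assumes "I \<subseteq> {1..n}" "i \<in> I" "j \<in> {1..n} - I" and \<epsilon>: "\<epsilon> \<in> E i j"
    and "x \<in> W c I" "f \<in> characters c"
    and "\<And>y. y \<in> W c (insert j (I - {i})) \<Longrightarrow> f y = \<one>\<^bsub>K\<^esub>"
    and "\<And>y. y \<in> W c (insert j I) \<Longrightarrow> f y = \<one>\<^bsub>K\<^esub>"
  shows "f (\<epsilon> x) = f x"
  using assms(1-3,5-)
proof (induction c arbitrary: f I x)
  case 0
  show ?case
    by (rule W1_exchange[OF 0(1-3) \<epsilon> _ 0(5)]) (use 0 in auto)
next
  case (Suc c)
  have ij: "i \<in> {1..n}" "j \<in> {1..n}" "i \<noteq> j" using Suc.prems by auto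
  note iso = E_iso[OF ij \<epsilon>]
  obtain y z A B where x: "x = commutator G y z" "A \<union> B = I" "y \<in> W c A" "z \<in> W1 B"
    using W_SucE[OF Suc.prems(4)] .
  have A: "A \<subseteq> {1..n}" "j \<notin> A" and B: "B \<subseteq> {1..n}" "j \<notin> B"
    using x(2) Suc.prems(1,3) by auto
  have y: "y \<in> lower_central G (Suc c)" using W_lower_central[OF A(1) x(3)] .
  have yG: "y \<in> carrier G" using G.lower_central_closed[OF y] .
  have \<epsilon>y: "\<epsilon> y \<in> lower_central G (Suc c)" using G.lower_central_iso[OF iso y] .
  have z: "z \<in> carrier G" using W1_closed[OF B(1)] x(4) by blast
  have \<epsilon>x: "f (\<epsilon> x) = f (commutator G (\<epsilon> y) (\<epsilon> z))"
    using x(1) iso_commutator[OF iso yG z] by simp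
  have kill: "f (commutator G u v) = \<one>\<^bsub>K\<^esub>"
    if "u \<in> W c P" "v \<in> W1 Q" "P \<union> Q = insert j (I - {i}) \<or> P \<union> Q = insert j I" for u v P Q
    using that(3) Suc.prems(6,7) W_SucI[OF that(1,2) refl] by metis
  note left = char_commutator_left[OF Suc.prems(5)]
  note right = char_commutator_right[OF Suc.prems(5)]
  show ?case
  proof (cases "i \<in> A")
    case iA: True
    \<comment> \<open>The second entry is restored first, while the first is still
      \<open>\<epsilon> y\<close>. Hence \<open>w\<close> has to range over the correction terms of
      \<open>z\<close> too, besides \<open>z\<close> itself.\<close>
    have moveA: "f (commutator G (\<epsilon> y) w) = f (commutator G y w)"
      if w: "w \<in> W1 Q" "Q \<subseteq> {1..n}"
        and Q: "Q = B \<or> Q = insert j (B - {i}) \<or> Q = insert j B" for w Q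
    proof (rule Suc.IH[OF A(1) iA _ x(3) left])
      show "w \<in> carrier G" using w W1_closed by blast
      show "j \<in> {1..n} - A" using A ij by simp
      fix u assume u: "u \<in> W c (insert j (A - {i}))"
      show "f (commutator G u w) = \<one>\<^bsub>K\<^esub>"
        by (rule kill[OF u w(1)]) (use Q x(2) iA ij in auto)
    next
      fix u assume u: "u \<in> W c (insert j A)"
      show "f (commutator G u w) = \<one>\<^bsub>K\<^esub>"
        by (rule kill[OF u w(1)]) (use Q x(2) iA ij in auto)
    qed
    have "f (commutator G (\<epsilon> y) (\<epsilon> z)) = f (commutator G (\<epsilon> y) z)"
    proof (cases "i \<in> B")
      case False
      then have "B \<inter> {i, j} = {}" using B by auto
      then show ?thesis using W1_inert[OF ij \<epsilon> B(1) _ x(4) right[OF \<epsilon>y]] by simp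
    next
      case iB: True
      show ?thesis
      proof (rule W1_exchange[OF B(1) iB _ \<epsilon> x(4) right[OF \<epsilon>y]])
        show "j \<in> {1..n} - B" using B ij by simp
        fix w assume "w \<in> W1 (insert j (B - {i})) \<union> W1 (insert j B)"
        then obtain Q where Q: "w \<in> W1 Q" "Q = insert j (B - {i}) \<or> Q = insert j B" by blast
        have Qn: "Q \<subseteq> {1..n}" using Q(2) B ij by auto
        \<comment> \<open>Vanishing is clear for \<open>y\<close> by the support of the commutator,
          and \<open>moveA\<close> transfers it to \<open>\<epsilon> y\<close>.\<close>
        have "f (commutator G y w) = \<one>\<^bsub>K\<^esub>"
          by (rule kill[OF x(3) Q(1)]) (use Q(2) x(2) iA in auto)
        then show "f (commutator G (\<epsilon> y) w) = \<one>\<^bsub>K\<^esub>"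
          using moveA[OF Q(1) Qn] Q(2) by auto
      qed
    qed
    then show ?thesis using moveA[OF x(4) B(1)] \<epsilon>x x(1) by simp
  next
    \<comment> \<open>Now \<open>A\<close> is inert, and removing \<open>i\<close> from
      \<open>B\<close> removes it from the whole support.\<close>
    case iA: False
    then have iB: "i \<in> B" using x(2) Suc.prems(2) by blast
    have "A \<inter> {i, j} = {}" using iA A by auto
    then have "f (commutator G (\<epsilon> y) (\<epsilon> z)) = f (commutator G y (\<epsilon> z))"
      using W_inert[OF ij \<epsilon> A(1) _ x(3) left[OF iso_closed[OF iso z]]] by simp
    also have "\<dots> = f (commutator G y z)"
    proof (rule W1_exchange[OF B(1) iB _ \<epsilon> x(4) right[OF y]])
      show "j \<in> {1..n} - B" using B ij by simp
      fix w assume "w \<in> W1 (insert j (B - {i})) \<union> W1 (insert j B)"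
      then obtain Q where Q: "w \<in> W1 Q" "Q = insert j (B - {i}) \<or> Q = insert j B" by blast
      show "f (commutator G y w) = \<one>\<^bsub>K\<^esub>"
        by (rule kill[OF x(3) Q(1)]) (use Q(2) x(2) iA in auto)
    qed
    finally show ?thesis using \<epsilon>x x(1) by simp
  qed
qed

text \<open>Here \<open>\<beta>\<close> will be the composite that induces
  \<open>F_mat n i j\<close>. Being an automorphism, it pulls a commutator back entry by entry, so
  nonvanishing of \<open>f\<close> on the transposed set becomes nonvanishing of
  \<open>f \<circ> \<beta>\<close> on \<open>I\<close>.\<close>

lemma W_swap:
  assumes \<beta>: "\<beta> \<in> iso G G" and ij: "i \<in> {1..n}" "j \<in> {1..n}"
    and swap: "\<And>I. I \<subseteq> {1..n} \<Longrightarrow> W1 (Transposition.transpose i j ` I) \<subseteq> \<beta> ` W1 I"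
    and "I \<subseteq> {1..n}"
  shows "W c (Transposition.transpose i j ` I) \<subseteq> \<beta> ` W c I"
  using assms(5)
proof (induction c arbitrary: I)
  case 0
  then show ?case using swap by simp
next
  case (Suc c)
  let ?\<tau> = "\<lambda>A. Transposition.transpose i j ` A"
  have invol: "?\<tau> (?\<tau> A) = A" for A by (simp add: image_comp)
  show ?case
  proof
    fix x assume "x \<in> W (Suc c) (?\<tau> I)"
    then obtain y z A B where x: "x = commutator G y z" "A \<union> B = ?\<tau> I" "y \<in> W c A" "z \<in> W1 B"
      by (rule W_SucE)
    have AB: "?\<tau> A \<union> ?\<tau> B = I" using x(2) invol[of I] by (simp add: image_Un[symmetric])
    then have sub: "?\<tau> A \<subseteq> {1..n}" "?\<tau> B \<subseteq> {1..n}" using Suc.prems by auto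
    obtain y' where y': "y' \<in> W c (?\<tau> A)" "y = \<beta> y'"
      using Suc.IH[OF sub(1)] x(3) invol by auto
    obtain z' where z': "z' \<in> W1 (?\<tau> B)" "z = \<beta> z'"
      using swap[OF sub(2)] x(4) invol by auto
    have "y' \<in> carrier G" "z' \<in> carrier G"
      using G.lower_central_closed W_lower_central[OF sub(1) y'(1)] W1_closed[OF sub(2)] z'(1) by auto
    then have "x = \<beta> (commutator G y' z')"
      using x(1) y'(2) z'(2) iso_commutator[OF \<beta>] by simp
    then show "x \<in> \<beta> ` W (Suc c) I"
      using W_SucI[OF y'(1) z'(1) AB] by blast
  qed
qed

section \<open>Lifting into the given subgroups, and bounds on the degree\<close>

lemma GI_subgroup: "I \<subseteq> {1..n} \<Longrightarrow> subgroup (GI I) G"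
  using n_group by (simp add: n_group_def)

lemma GI_commutator:
  assumes "B \<subseteq> {1..n}" "x \<in> GI B" "y \<in> GI B"
  shows "commutator G x y \<in> GI B"
proof -
  interpret B: subgroup "GI B" G using GI_subgroup[OF assms(1)] .
  show ?thesis using assms(2,3) by (simp add: commutator_def)
qed

text \<open>Entries are lifted one by one, and \<open>GI B\<close> is closed under commutators. The
  lift must not depend on \<open>f\<close>, because in the induction the character of one entry
  involves the other entry.\<close>

lemma W_lift:
  assumes "I \<subseteq> B" "B \<subseteq> {1..n}" "d \<le> card B" "x \<in> W c I"
  shows "\<exists>x'\<in>GI B \<inter> lower_central G (Suc c). \<forall>f\<in>characters c. f x' = f x"
  using assms(1,4)
proof (induction c arbitrary: I x)
  case 0
  then obtain x' where "x' \<in> GI B" "\<forall>f\<in>characters 0. f x' = f x"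
    using W1_lift[OF 0(1) assms(2,3), of x] 0(2) unfolding W.simps by blast
  then show ?case
    using subgroup.subset[OF GI_subgroup[OF assms(2)]] by (intro bexI[of _ x']) auto
next
  case (Suc c)
  obtain y z P Q where x: "x = commutator G y z" "P \<union> Q = I" "y \<in> W c P" "z \<in> W1 Q"
    using W_SucE[OF Suc.prems(2)] .
  have PQ: "P \<subseteq> B" "Q \<subseteq> B" using x(2) Suc.prems(1) by auto
  obtain y' where y': "y' \<in> GI B" "y' \<in> lower_central G (Suc c)" "\<And>f. f \<in> characters c \<Longrightarrow> f y' = f y"
    using Suc.IH[OF PQ(1) x(3)] by blast
  obtain z' where z': "z' \<in> GI B" "\<And>f. f \<in> characters 0 \<Longrightarrow> f z' = f z"
    using W1_lift[OF PQ(2) assms(2,3) x(4)] by blast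
  have z: "z \<in> carrier G" "z' \<in> carrier G"
    using W1_closed[of Q] PQ(2) assms(2) x(4) subgroup.subset[OF GI_subgroup[OF assms(2)]] z'(1) by auto
  show ?case
  proof (intro bexI ballI)
    show "commutator G y' z' \<in> GI B \<inter> lower_central G (Suc (Suc c))"
      using GI_commutator[OF assms(2) y'(1) z'(1)] G.commutator_in_lower_central[OF y'(2) z(2)] by blast
    fix f assume f: "f \<in> characters (Suc c)"
    show "f (commutator G y' z') = f x"
      using y'(3)[OF char_commutator_left[OF f z(1)]] z'(2)[OF char_commutator_right[OF f y'(2)]] x(1)
      by simp
  qed
qed

text \<open>Common induction step of both degree bounds: an entry whose support is too large already
  kills the commutator, which leaves the case of two small supports.\<close>

lemma W_degree_SucI:
  assumes "I \<subseteq> {1..n}" "x \<in> W (Suc c) I" "f \<in> characters (Suc c)"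
    and IH: "\<And>A y f. A \<subseteq> {1..n} \<Longrightarrow> k < card A \<Longrightarrow> y \<in> W c A \<Longrightarrow> f \<in> characters c \<Longrightarrow> f y = \<one>\<^bsub>K\<^esub>"
    and small: "\<And>y z A B. A \<union> B = I \<Longrightarrow> y \<in> W c A \<Longrightarrow> z \<in> W1 B \<Longrightarrow> card A \<le> k \<Longrightarrow> card B \<le> d
      \<Longrightarrow> f (commutator G y z) = \<one>\<^bsub>K\<^esub>"
  shows "f x = \<one>\<^bsub>K\<^esub>"
proof -
  obtain y z A B where x: "x = commutator G y z" "A \<union> B = I" "y \<in> W c A" "z \<in> W1 B"
    using W_SucE[OF assms(2)] .
  have AB: "A \<subseteq> {1..n}" "B \<subseteq> {1..n}" using x(2) assms(1) by auto
  have z: "z \<in> carrier G" using W1_closed[OF AB(2)] x(4) by blast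
  consider "k < card A" | "d < card B" | "card A \<le> k" "card B \<le> d" by linarith
  then show ?thesis
  proof cases
    case 1
    then show ?thesis using IH[OF AB(1) _ x(3) char_commutator_left[OF assms(3) z]] x(1) by simp
  next
    case 2
    then show ?thesis
      using W1_degree[OF AB(2) _ x(4) char_commutator_right[OF assms(3) W_lower_central[OF AB(1) x(3)]]] x(1)
      by simp
  next
    case 3
    then show ?thesis using small[OF x(2-4)] x(1) by simp
  qed
qed

text \<open>Each of the \<open>c + 1\<close> entries contributes at most \<open>d\<close> elements
  to the support.\<close>

lemma W_degree:
  assumes "I \<subseteq> {1..n}" "Suc c * d < card I" "x \<in> W c I" "f \<in> characters c"
  shows "f x = \<one>\<^bsub>K\<^esub>"
  using assms
proof (induction c arbitrary: I x f)
  case 0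
  then show ?case using W1_degree by simp
next
  case (Suc c)
  show ?case
  proof (rule W_degree_SucI[OF Suc.prems(1,3,4)])
    show "f y = \<one>\<^bsub>K\<^esub>" if "A \<subseteq> {1..n}" "Suc c * d < card A" "y \<in> W c A" "f \<in> characters c" for A y f
      using Suc.IH that by blast
    show "f (commutator G y z) = \<one>\<^bsub>K\<^esub>" if "A \<union> B = I" "card A \<le> Suc c * d" "card B \<le> d" for y z A B
      using that card_Un_le[of A B] Suc.prems(2) by simp
  qed
qed

text \<open>With weak commutativity the commutators with disjoint supports vanish modulo the next term
  of the lower central series, so each further commutator enlarges the support by at most \<open>d - 1\<close>.\<close>

lemma W_degree_weakly_commuting:
  assumes weak: "weakly_commuting n G GI" and d: "1 \<le> d"
    and "I \<subseteq> {1..n}" "Suc c * (d - 1) + 1 < card I" "Suc c * (d - 1) + 1 < n" "x \<in> W c I" "f \<in> characters c"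
  shows "f x = \<one>\<^bsub>K\<^esub>"
  using assms(3-)
proof (induction c arbitrary: I x f)
  case 0
  then show ?case using W1_degree d by simp
next
  case (Suc c)
  let ?k = "Suc c * (d - 1) + 1"
  have kn: "?k + d \<le> n" using Suc.prems(3) d by simp
  have dk: "d \<le> ?k" using d by simp
  show ?case
  proof (rule W_degree_SucI[OF Suc.prems(1,4,5)])
    show "f y = \<one>\<^bsub>K\<^esub>" if "A \<subseteq> {1..n}" "?k < card A" "y \<in> W c A" "f \<in> characters c" for A y f
      using Suc.IH[OF that(1,2) _ that(3,4)] Suc.prems(3) by simp
    fix y z A B
    assume AB: "A \<union> B = I" and y: "y \<in> W c A" and z: "z \<in> W1 B" and cA: "card A \<le> ?k" and cB: "card B \<le> d"
    have sub: "A \<subseteq> {1..n}" "B \<subseteq> {1..n}" using AB Suc.prems(1) by auto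
    have fin: "finite A" "finite B" using sub finite_subset by blast+
    \<comment> \<open>A common element would leave at most \<open>?k + d - 1\<close> elements in
      \<open>I\<close>, which is exactly the claimed bound.\<close>
    have disj: "A \<inter> B = {}"
    proof (rule ccontr)
      assume "A \<inter> B \<noteq> {}"
      then have "card (A \<inter> B) > 0" using fin by (simp add: card_gt_0_iff)
      then show False
        using card_Un_Int[OF fin] AB cA cB Suc.prems(2) d by simp
    qed
    have "card ({1..n} - A) = n - card A" using sub(1) fin by (simp add: card_Diff_subset)
    then have "d \<le> card ({1..n} - A)" using cA kn by simp
    \<comment> \<open>\<open>B\<close> grows to \<open>d\<close> elements outside \<open>A\<close>,
      and \<open>A\<close> to the complement of \<open>Q\<close>. As \<open>?k + d \<le> n\<close>,
      both are large enough for lifting.\<close>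
    then obtain Q where Q: "B \<subseteq> Q" "Q \<subseteq> {1..n} - A" "card Q = d"
      using exists_subset_between[of B d "{1..n} - A"] cB sub(2) disj by auto
    define P where "P = {1..n} - Q"
    have "finite Q" using Q(2) finite_subset by blast
    then have "card P = n - d" unfolding P_def using Q by (subst card_Diff_subset) auto
    then have P: "A \<subseteq> P" "P \<subseteq> {1..n}" "d \<le> card P" "P \<inter> Q = {}"
      unfolding P_def using sub(1) Q(2) kn dk by auto
    have Qn: "Q \<subseteq> {1..n}" using Q(2) by blast
    obtain y' where y': "y' \<in> GI P" "y' \<in> lower_central G (Suc c)" "\<And>f. f \<in> characters c \<Longrightarrow> f y' = f y"
      using W_lift[OF P(1-3) y] by blast
    obtain z' where z': "z' \<in> GI Q" "\<And>f. f \<in> characters 0 \<Longrightarrow> f z' = f z"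
      using W1_lift[OF Q(1) Qn _ z] Q(3) by auto
    have zG: "z \<in> carrier G" "z' \<in> carrier G"
      using W1_closed[OF sub(2)] z subgroup.subset[OF GI_subgroup[OF Qn]] z'(1) by auto
    obtain g where g: "g \<in> carrier G"
      "commute_elementwise G ((\<lambda>x. inv g \<otimes> x \<otimes> g) ` GI P) (GI Q)"
      using weak[unfolded weakly_commuting_def, rule_format, of P Q] P(2,4) Qn by auto
    \<comment> \<open>Conjugation by \<open>g\<close> does not change the value of a character, but
      makes the first entry commute with \<open>z'\<close>.\<close>
    define u where "u = inv g \<otimes> y' \<otimes> g"
    have "u \<otimes> z' = z' \<otimes> u" using g(2) y'(1) z'(1) by (auto simp: commute_elementwise_def u_def)
    moreover have "u \<in> carrier G" using g(1) G.lower_central_closed[OF y'(2)] by (simp add: u_def)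
    ultimately have "commutator G u z' = \<one>" using G.commutator_eq_one zG by blast
    moreover have "f (commutator G u z') = f (commutator G y' z')"
      unfolding u_def by (rule char_conj(2)[OF char_commutator_left[OF Suc.prems(5) zG(2)] y'(2) g(1)])
    moreover have "f (commutator G y' z') = f (commutator G y' z)"
      using z'(2)[OF char_commutator_right[OF Suc.prems(5) y'(2)]] .
    moreover have "f (commutator G y' z) = f (commutator G y z)"
      using y'(3)[OF char_commutator_left[OF Suc.prems(5) zG(1)]] .
    ultimately show "f (commutator G y z) = \<one>\<^bsub>K\<^esub>" using char_one[OF Suc.prems(5)] by simp
  qed
qed

end

section \<open>Centralizing sequences from disjoint intervals\<close>

context two_groups
begin

text \<open>All commutators demanded by the definition are chosen to be trivial: the elements of
  \<open>cs\<close> are tested against the head of \<open>cs\<close>, those of \<open>xs\<close>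
  against a suitable member of \<open>cs\<close>.\<close>

lemma rho_CG_append:
  assumes cs: "cs \<noteq> []" "set cs \<subseteq> C_rho G K \<rho>"
    and comm_hd: "\<And>c. c \<in> set cs \<Longrightarrow> c \<otimes> cs ! 0 = cs ! 0 \<otimes> c"
    and comm: "\<And>x. x \<in> set xs \<Longrightarrow> \<exists>c\<in>set cs. x \<otimes> c = c \<otimes> x"
    and gen: "set xs \<subseteq> carrier G" "generate G (set xs) = carrier G"
  shows "rho_CG G K \<rho> (cs @ xs)"
proof -
  have cG: "set cs \<subseteq> carrier G" using cs(2) by (auto simp: C_rho_def)
  have "\<exists>j<i. (cs @ xs) ! j \<in> C_rho G K \<rho> \<and>
      commutator G ((cs @ xs) ! i) ((cs @ xs) ! j) \<in> generate G (set (take i (cs @ xs)))"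
    if i: "1 \<le> i" "i < length (cs @ xs)" for i
  proof -
    have "\<exists>j<i. j < length cs \<and> (cs @ xs) ! i \<otimes> cs ! j = cs ! j \<otimes> (cs @ xs) ! i"
    proof (cases "i < length cs")
      case True
      then show ?thesis using i comm_hd by (intro exI[of _ 0]) (auto simp: nth_append)
    next
      case False
      then obtain c where "c \<in> set cs" "(cs @ xs) ! i \<otimes> c = c \<otimes> (cs @ xs) ! i"
        using comm[of "(cs @ xs) ! i"] i by (auto simp: nth_append)
      moreover obtain j where "j < length cs" "c = cs ! j"
        using \<open>c \<in> set cs\<close> by (auto simp: in_set_conv_nth)
      ultimately show ?thesis using False by (intro exI[of _ j]) auto
    qed
    then obtain j where j: "j < i" "j < length cs" "(cs @ xs) ! i \<otimes> cs ! j = cs ! j \<otimes> (cs @ xs) ! i"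
      by blast
    have "(cs @ xs) ! i \<in> carrier G" using nth_mem[OF i(2)] cG gen(1) by auto
    moreover have "cs ! j \<in> carrier G" using cG j(2) nth_mem by blast
    ultimately have "commutator G ((cs @ xs) ! i) (cs ! j) = \<one>"
      using G.commutator_eq_one j(3) by blast
    then show ?thesis
      using j cs(2) by (intro exI[of _ j]) (auto simp: nth_append generate.one)
  qed
  moreover have "generate G (set (cs @ xs)) = carrier G"
    using G.mono_generate[of "set xs" "set (cs @ xs)"] gen cG G.generate_incl[of "set (cs @ xs)"] by auto
  moreover have "cs ! 0 \<in> C_rho G K \<rho>" using cs nth_mem by blast
  ultimately show ?thesis
    using cs(1) cG gen(1) by (auto simp: rho_CG_def rho_centralizing_def nth_append)
qed

text \<open>\<open>\<alpha>\<close> maps onto \<open>G\<close>, so \<open>\<rho>\<close> and its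
  twist have the same image and the same central values. A sequence found for the twist can
  therefore be carried back to \<open>\<rho>\<close>.\<close>

lemma rho_CG_map_iso:
  assumes \<alpha>: "\<alpha> \<in> iso G G" and CG: "rho_CG G K (\<lambda>x. \<rho> (\<alpha> x)) gs"
  shows "rho_CG G K \<rho> (map \<alpha> gs)"
proof -
  interpret \<alpha>: group_hom G G \<alpha>
    using \<alpha> by unfold_locales (simp add: iso_def)
  have surj: "\<alpha> ` carrier G = carrier G"
    using \<alpha> by (auto simp: iso_def bij_betw_def)
  have image: "(\<lambda>x. \<rho> (\<alpha> x)) ` carrier G = \<rho> ` carrier G"
    using surj by (metis image_image)
  have C: "\<alpha> x \<in> C_rho G K \<rho>" if "x \<in> C_rho G K (\<lambda>x. \<rho> (\<alpha> x))" for x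
    using that unfolding C_rho_def image by auto
  have gs: "gs \<noteq> []" "set gs \<subseteq> carrier G" "gs ! 0 \<in> C_rho G K (\<lambda>x. \<rho> (\<alpha> x))"
    "generate G (set gs) = carrier G"
    "\<And>i. 1 \<le> i \<Longrightarrow> i < length gs \<Longrightarrow> \<exists>j<i. gs ! j \<in> C_rho G K (\<lambda>x. \<rho> (\<alpha> x)) \<and>
       commutator G (gs ! i) (gs ! j) \<in> generate G (set (take i gs))"
    using CG unfolding rho_CG_def rho_centralizing_def by simp_all
  have "\<exists>j<i. map \<alpha> gs ! j \<in> C_rho G K \<rho> \<and>
      commutator G (map \<alpha> gs ! i) (map \<alpha> gs ! j) \<in> generate G (set (take i (map \<alpha> gs)))"
    if i: "1 \<le> i" "i < length gs" for i
  proof -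
    obtain j where j: "j < i" "gs ! j \<in> C_rho G K (\<lambda>x. \<rho> (\<alpha> x))"
      "commutator G (gs ! i) (gs ! j) \<in> generate G (set (take i gs))"
      using gs(5)[OF i] by blast
    have mem: "gs ! i \<in> carrier G" "gs ! j \<in> carrier G" using gs(2) i j(1) by auto
    have "set (take i gs) \<subseteq> carrier G" by (rule order_trans[OF set_take_subset gs(2)])
    then have "generate G (set (take i (map \<alpha> gs))) = \<alpha> ` generate G (set (take i gs))"
      using \<alpha>.generate_img by (simp add: take_map)
    then show ?thesis
      using j i C[OF j(2)] imageI[OF j(3), of \<alpha>] G.hom_commutator[OF G.group_axioms \<alpha>.homh mem]
      by (intro exI[of _ j]) simp
  qed
  moreover have "generate G (set (map \<alpha> gs)) = carrier G"
    using \<alpha>.generate_img[OF gs(2)] gs(4) surj by simp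
  ultimately show ?thesis
    using gs(1-3) C by (auto simp: rho_CG_def rho_centralizing_def)
qed

lemma hom_character:
  assumes "\<rho> \<in> hom G K" "\<And>x. x \<in> lower_central G (Suc (Suc c)) \<Longrightarrow> \<rho> x = \<one>\<^bsub>K\<^esub>"
  shows "\<rho> \<in> characters c"
  using assms G.lower_central_closed by (intro charactersI) (auto simp: hom_def)

lemma C_rhoI:
  assumes "\<rho> \<in> hom G K" "\<And>x. x \<in> lower_central G (Suc (Suc c)) \<Longrightarrow> \<rho> x = \<one>\<^bsub>K\<^esub>"
    and x: "x \<in> lower_central G (Suc c)" "\<rho> x \<noteq> \<one>\<^bsub>K\<^esub>"
  shows "x \<in> C_rho G K \<rho>"
proof -
  interpret \<rho>: group_hom G K \<rho> using assms(1) by unfold_locales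
  note xG = G.lower_central_closed[OF x(1)]
  have "\<rho> x \<otimes>\<^bsub>K\<^esub> \<rho> y = \<rho> y \<otimes>\<^bsub>K\<^esub> \<rho> x" if y: "y \<in> carrier G" for y
  proof -
    have "\<rho> (x \<otimes> y) = \<rho> (y \<otimes> x \<otimes> commutator G x y)"
      using G.mult_eq_mult_commutator[OF xG y] by simp
    then show ?thesis
      using xG y assms(2)[OF G.commutator_in_lower_central[OF x(1) y]] by simp
  qed
  then show ?thesis using xG x(2) by (auto simp: C_rho_def)
qed

end

context regular_group
begin

text \<open>The state \<open>\<alpha>\<close> stands for the character
  \<open>\<rho> \<circ> \<alpha>\<close>. Steps compose on the right, so that this character is
  evaluated at \<open>\<epsilon> x\<close> and the results on \<open>W\<close> apply to it. By
  \<open>max\<close> it vanishes on sets of size \<open>m + 1\<close>, which covers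
  \<open>insert j I\<close>.\<close>

lemma spreading_characters:
  assumes \<rho>: "\<rho> \<in> characters c"
    and max: "\<And>\<alpha> I x. \<alpha> \<in> iso G G \<Longrightarrow> I \<subseteq> {1..n} \<Longrightarrow> m < card I \<Longrightarrow> x \<in> W c I \<Longrightarrow> \<rho> (\<alpha> x) = \<one>\<^bsub>K\<^esub>"
  shows "spreading n m (iso G G) (\<lambda>i j \<alpha> \<alpha>'. \<exists>\<epsilon>\<in>E i j. \<alpha>' = \<alpha> \<circ> \<epsilon>)
    (\<lambda>\<alpha> I. \<exists>x\<in>W c I. \<rho> (\<alpha> x) \<noteq> \<one>\<^bsub>K\<^esub>)"
proof
  fix i j \<alpha> \<alpha>' assume ij: "i \<in> {1..n}" "j \<in> {1..n}" "i \<noteq> j" and \<alpha>: "\<alpha> \<in> iso G G"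
    and "\<exists>\<epsilon>\<in>E i j. \<alpha>' = \<alpha> \<circ> \<epsilon>"
  then obtain \<epsilon> where \<epsilon>: "\<epsilon> \<in> E i j" "\<alpha>' = \<alpha> \<circ> \<epsilon>" by blast
  show "\<alpha>' \<in> iso G G"
    unfolding \<epsilon>(2) by (rule iso_set_trans[OF E_iso[OF ij \<epsilon>(1)] \<alpha>])
  fix I assume I: "I \<subseteq> {1..n}" "I \<inter> {i, j} = {}"
  have "\<rho> (\<alpha>' x) = \<rho> (\<alpha> x)" if "x \<in> W c I" for x
    using W_inert[OF ij \<epsilon>(1) I that char_iso[OF \<rho> \<alpha>]] \<epsilon>(2) by simp
  then show "(\<exists>x\<in>W c I. \<rho> (\<alpha>' x) \<noteq> \<one>\<^bsub>K\<^esub>) = (\<exists>x\<in>W c I. \<rho> (\<alpha> x) \<noteq> \<one>\<^bsub>K\<^esub>)" by auto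
next
  fix i j \<alpha> \<alpha>' I assume \<alpha>: "\<alpha> \<in> iso G G" and "\<exists>\<epsilon>\<in>E i j. \<alpha>' = \<alpha> \<circ> \<epsilon>"
    and I: "I \<subseteq> {1..n}" "card I = m" "i \<in> I" "j \<in> {1..n} - I"
    and nz: "\<exists>x\<in>W c I. \<rho> (\<alpha> x) \<noteq> \<one>\<^bsub>K\<^esub>"
    and z: "\<not> (\<exists>x\<in>W c (insert j (I - {i})). \<rho> (\<alpha> x) \<noteq> \<one>\<^bsub>K\<^esub>)"
  then obtain \<epsilon> where \<epsilon>: "\<epsilon> \<in> E i j" "\<alpha>' = \<alpha> \<circ> \<epsilon>" by blast
  have "finite I" using I(1) finite_subset by blast
  then have "m < card (insert j I)" using I by simp
  then have top: "\<rho> (\<alpha> y) = \<one>\<^bsub>K\<^esub>" if "y \<in> W c (insert j I)" for y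
    using max[OF \<alpha> _ _ that] I by blast
  have "\<rho> (\<alpha>' x) = \<rho> (\<alpha> x)" if "x \<in> W c I" for x
    using W_exchange[OF I(1,3,4) \<epsilon>(1) that char_iso[OF \<rho> \<alpha>]] z top \<epsilon>(2) by auto
  then show "\<exists>x\<in>W c I. \<rho> (\<alpha>' x) \<noteq> \<one>\<^bsub>K\<^esub>" using nz by auto
next
  fix i j \<alpha> assume ij: "i \<in> {1..n}" "j \<in> {1..n}" "i \<noteq> j" and \<alpha>: "\<alpha> \<in> iso G G"
  let ?step = "\<lambda>\<alpha> \<alpha>'. \<exists>\<epsilon>\<in>E i j. \<alpha>' = \<alpha> \<circ> \<epsilon>"
  obtain \<epsilon>\<^sub>1 \<epsilon>\<^sub>2 \<epsilon>\<^sub>3 where \<epsilon>: "\<epsilon>\<^sub>1 \<in> E i j" "\<epsilon>\<^sub>2 \<in> E i j" "\<epsilon>\<^sub>3 \<in> E i j"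
    and sw: "\<And>I. I \<subseteq> {1..n} \<Longrightarrow> W1 (Transposition.transpose i j ` I) \<subseteq> (\<lambda>x. \<epsilon>\<^sub>1 (\<epsilon>\<^sub>2 (\<epsilon>\<^sub>3 x))) ` W1 I"
    using W1_swap[OF ij] by blast
  define \<beta> where "\<beta> = \<epsilon>\<^sub>1 \<circ> \<epsilon>\<^sub>2 \<circ> \<epsilon>\<^sub>3"
  have \<beta>: "\<beta> \<in> iso G G" 
    unfolding \<beta>_def using iso_set_trans[of _ G G _ G] E_iso[OF ij] \<epsilon> by simp
  have append: "?step\<^sup>*\<^sup>* \<alpha> (\<gamma> \<circ> \<epsilon>)" if "?step\<^sup>*\<^sup>* \<alpha> \<gamma>" "\<epsilon> \<in> E i j" for \<gamma> \<epsilon>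
    by (rule rtranclp.rtrancl_into_rtrancl[OF that(1)]) (rule bexI[OF refl that(2)])
  have steps: "?step\<^sup>*\<^sup>* \<alpha> (\<alpha> \<circ> \<beta>)"
    unfolding \<beta>_def o_assoc by (intro append \<epsilon> rtranclp.rtrancl_refl)
  have "\<exists>x\<in>W c I. \<rho> ((\<alpha> \<circ> \<beta>) x) \<noteq> \<one>\<^bsub>K\<^esub>"
    if I: "I \<subseteq> {1..n}" and nz: "\<exists>x\<in>W c (Transposition.transpose i j ` I). \<rho> (\<alpha> x) \<noteq> \<one>\<^bsub>K\<^esub>" for I
  proof -
    have "W c (Transposition.transpose i j ` I) \<subseteq> \<beta> ` W c I"
      using W_swap[OF \<beta> ij(1,2) _ I] sw by (simp add: \<beta>_def comp_def)
    then show ?thesis using nz by auto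
  qed
  then show "\<exists>\<alpha>'. ?step\<^sup>*\<^sup>* \<alpha> \<alpha>' \<and> (\<forall>I. I \<subseteq> {1..n} \<longrightarrow>
      (\<exists>x\<in>W c (Transposition.transpose i j ` I). \<rho> (\<alpha> x) \<noteq> \<one>\<^bsub>K\<^esub>) \<longrightarrow> (\<exists>x\<in>W c I. \<rho> (\<alpha>' x) \<noteq> \<one>\<^bsub>K\<^esub>))"
    using steps by blast
qed

text \<open>The degree bound \<open>k\<close> is kept abstract, so that both numerical hypotheses
  can be fed into the same construction.\<close>

lemma exists_rho_CG:
  assumes \<rho>: "\<rho> \<in> hom G K"
    and trivial: "\<And>x. x \<in> lower_central G (Suc (Suc c)) \<Longrightarrow> \<rho> x = \<one>\<^bsub>K\<^esub>"
    and nontrivial: "\<exists>x\<in>lower_central G (Suc c). \<rho> x \<noteq> \<one>\<^bsub>K\<^esub>"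
    and degree: "\<And>I x f. I \<subseteq> {1..n} \<Longrightarrow> k < card I \<Longrightarrow> x \<in> W c I \<Longrightarrow> f \<in> characters c \<Longrightarrow> f x = \<one>\<^bsub>K\<^esub>"
    and dk: "d \<le> k" and kn: "(d + 1) * k \<le> n"
    and fg: "finitely_generated G" and gen: "generated_in_degree d n G GI"
  shows "\<exists>gs. rho_CG G K \<rho> gs"
proof -
  have char: "\<rho> \<in> characters c" using hom_character[OF \<rho> trivial] .
  define nz where "nz = (\<lambda>\<alpha> I. \<exists>x\<in>W c I. \<rho> (\<alpha> x) \<noteq> \<one>\<^bsub>K\<^esub>)"
  define P where "P p \<longleftrightarrow> fst p \<in> iso G G \<and> snd p \<subseteq> {1..n} \<and> nz (fst p) (snd p)"
    for p :: "('a \<Rightarrow> 'a) \<times> nat set"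
  have id: "id \<in> iso G G" by (auto simp: iso_def hom_def)
  have "\<exists>I. I \<subseteq> {1..n} \<and> nz id I"
  proof (rule ccontr)
    assume "\<not> ?thesis"
    then have "\<rho> x = \<one>\<^bsub>K\<^esub>" if "I \<subseteq> {1..n}" "x \<in> W c I" for I x
      using that by (auto simp: nz_def)
    then show False using W_generate[OF char] nontrivial by blast
  qed
  then obtain I where "I \<subseteq> {1..n}" "nz id I" by blast
  then have P0: "P (id, I)" by (simp add: P_def id)
  have bound: "card (snd p) \<le> k" if "P p" for p
  proof -
    obtain x where x: "fst p \<in> iso G G" "snd p \<subseteq> {1..n}" "x \<in> W c (snd p)" "\<rho> (fst p x) \<noteq> \<one>\<^bsub>K\<^esub>"
      using \<open>P p\<close> unfolding P_def nz_def by blast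
    show ?thesis using degree[OF x(2) _ x(3) char_iso[OF char x(1)]] x(4) by force
  qed
  \<comment> \<open>The size is maximized over all twists of \<open>\<rho>\<close>, so that its
    maximality survives every move.\<close>
  have "\<exists>p. P p \<and> (\<forall>q. P q \<longrightarrow> card (snd q) \<le> card (snd p))"
    by (rule ex_has_greatest_nat[where P = P and k = "(id, I)" and b = "Suc k"])
      (use P0 bound in \<open>auto simp: less_Suc_eq_le\<close>)
  then obtain p where p: "P p" "\<And>q. P q \<Longrightarrow> card (snd q) \<le> card (snd p)"
    by blast
  define m where "m = card (snd p)"
  have mk: "m \<le> k" using bound[OF p(1)] by (simp add: m_def)
  interpret spreading n m "iso G G" "\<lambda>i j \<alpha> \<alpha>'. \<exists>\<epsilon>\<in>E i j. \<alpha>' = \<alpha> \<circ> \<epsilon>" nz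
    unfolding nz_def
  proof (rule spreading_characters[OF char])
    fix \<alpha> I x assume "\<alpha> \<in> iso G G" "I \<subseteq> {1..n}" "m < card I" "x \<in> W c I"
    then show "\<rho> (\<alpha> x) = \<one>\<^bsub>K\<^esub>"
      using p(2)[of "(\<alpha>, I)"] unfolding P_def nz_def m_def by (metis fst_conv snd_conv not_le)
  qed
  \<comment> \<open>The blocks \<open>B t\<close> with \<open>t \<le> d\<close> fit because
    \<open>(d + 1) * k \<le> n\<close>. Nonvanishing is available only on sets of the true maximal
    size \<open>m\<close>, hence the initial segments \<open>T t\<close>; lifting needs the whole
    block, as \<open>d \<le> k\<close>.\<close>
  define B where "B t = {t * k + 1..t * k + k}" for t
  define T where "T t = {t * k + 1..t * k + m}" for t
  have TB: "T t \<subseteq> B t" for t using mk by (auto simp: T_def B_def)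
  have B: "B t \<subseteq> {1..n}" if "t \<le> d" for t
  proof -
    have "t * k + k \<le> (d + 1) * k" using mult_le_mono1[of "t + 1" "d + 1" k] that by simp
    then have "t * k + k \<le> n" using kn by (rule order_trans)
    then show ?thesis by (auto simp: B_def)
  qed
  have card: "card (B t) = k" "card (T t) = m" for t by (auto simp: B_def T_def)
  have disj_less: "B t \<inter> B u = {}" if "t < u" for t u
  proof -
    have "t * k + k \<le> u * k" using mult_le_mono1[of "t + 1" u k] that by simp
    then show ?thesis by (auto simp: B_def)
  qed
  then have disj: "B t \<inter> B u = {}" if "t \<noteq> u" for t u
    using that by (metis Int_commute linorder_neqE_nat)
  have Tn: "T t \<subseteq> {1..n}" if "t \<le> d" for t
    using TB B[OF that] by (rule order_trans)
  have "T t \<inter> T u = {}" if "t < u" for t u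
    using TB[of t] TB[of u] disj_less[OF that] by blast
  then have "\<exists>\<alpha>\<in>iso G G. \<forall>t\<le>d. nz \<alpha> (T t)"
    using p(1) by (intro simultaneously_nonzero[of "fst p" "snd p" d T] Tn card(2)) (simp_all add: P_def m_def)
  then obtain \<alpha> where \<alpha>: "\<alpha> \<in> iso G G" "\<And>t. t \<le> d \<Longrightarrow> nz \<alpha> (T t)" by blast
  have "\<exists>x\<in>GI (B t) \<inter> lower_central G (Suc c). \<rho> (\<alpha> x) \<noteq> \<one>\<^bsub>K\<^esub>" if t: "t \<le> d" for t
  proof -
    obtain x where x: "x \<in> W c (T t)" "\<rho> (\<alpha> x) \<noteq> \<one>\<^bsub>K\<^esub>" using \<alpha>(2)[OF t] by (auto simp: nz_def)
    obtain x' where x': "x' \<in> GI (B t) \<inter> lower_central G (Suc c)" "\<And>f. f \<in> characters c \<Longrightarrow> f x' = f x"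
      using W_lift[OF TB B[OF t] dk[folded card(1)[of t]] x(1)] by blast
    show ?thesis
      using x'(2)[OF char_iso[OF char \<alpha>(1)]] x(2) by (intro bexI[OF _ x'(1)]) simp
  qed
  then have "\<exists>x. \<forall>t\<le>d. x t \<in> GI (B t) \<inter> lower_central G (Suc c) \<and> \<rho> (\<alpha> (x t)) \<noteq> \<one>\<^bsub>K\<^esub>"
    by (intro choice) blast
  then obtain x where x: "\<And>t. t \<le> d \<Longrightarrow> x t \<in> GI (B t)"
    "\<And>t. t \<le> d \<Longrightarrow> x t \<in> lower_central G (Suc c)" "\<And>t. t \<le> d \<Longrightarrow> \<rho> (\<alpha> (x t)) \<noteq> \<one>\<^bsub>K\<^esub>"
    by blast
  have commute: "y \<otimes> x t = x t \<otimes> y" if "t \<le> d" "J \<subseteq> {1..n}" "B t \<inter> J = {}" "y \<in> GI J" for t J y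
  proof -
    have "consecutive (B t)"
      unfolding consecutive_def card(1) by (rule exI[of _ "t * k + 1"]) (auto simp: B_def)
    then show ?thesis
      using partially_commuting[unfolded partially_commuting_def, rule_format, of "B t" J]
        B[OF that(1)] that x(1)[OF that(1)] by (simp add: commute_elementwise_def)
  qed
  define U where "U = (\<Union>J\<in>{J. J \<subseteq> {1..n} \<and> card J = d}. GI J)"
  have "U \<subseteq> carrier G" unfolding U_def using subgroup.subset[OF GI_subgroup] by blast
  moreover have "generate G U = carrier G" using gen by (simp add: generated_in_degree_def U_def)
  ultimately obtain X where X: "finite X" "X \<subseteq> U" "generate G X = carrier G" "X \<subseteq> carrier G"
    using G.finitely_generated_finite_subset[OF fg, of U] by auto
  obtain xs where xs: "set xs = X" using finite_list[OF X(1)] by blast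
  have "rho_CG G K (\<lambda>y. \<rho> (\<alpha> y)) (map x [0..<Suc d] @ xs)"
  proof (rule rho_CG_append)
    have "(\<lambda>y. \<rho> (\<alpha> y)) \<in> hom G K"
      using hom_compose[of \<alpha> G G \<rho> K] \<rho> \<alpha>(1) by (simp add: iso_def comp_def)
    then have "x t \<in> C_rho G K (\<lambda>y. \<rho> (\<alpha> y))" if "t \<le> d" for t
      using trivial G.lower_central_iso[OF \<alpha>(1)] x(2,3)[OF that] by (intro C_rhoI[where c = c]) simp_all
    then show "set (map x [0..<Suc d]) \<subseteq> C_rho G K (\<lambda>y. \<rho> (\<alpha> y))" by (auto simp del: upt_Suc)
    fix y assume "y \<in> set (map x [0..<Suc d])"
    then obtain t where t: "y = x t" "t \<le> d" by (auto simp del: upt_Suc)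
    have "y \<otimes> x 0 = x 0 \<otimes> y"
    proof (cases "t = 0")
      case False
      then show ?thesis using commute[of 0 "B t" y] disj[of 0 t] B t x(1) by simp
    qed (simp add: t)
    then show "y \<otimes> map x [0..<Suc d] ! 0 = map x [0..<Suc d] ! 0 \<otimes> y" by (simp del: upt_Suc)
  next
    fix y assume "y \<in> set xs"
    then obtain J where J: "J \<subseteq> {1..n}" "card J = d" "y \<in> GI J" using xs X(2) by (auto simp: U_def)
    \<comment> \<open>Pigeonhole: \<open>d + 1\<close> disjoint blocks cannot all meet a set of
      \<open>d\<close> elements.\<close>
    have "\<exists>t\<le>d. B t \<inter> J = {}"
    proof (rule ccontr)
      assume "\<not> ?thesis"
      then have "\<exists>h. \<forall>t\<le>d. h t \<in> B t \<inter> J" by (intro choice) blast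
      then obtain h where h: "\<And>t. t \<le> d \<Longrightarrow> h t \<in> B t \<inter> J" by blast
      have "inj_on h {..d}"
        using h disj by (intro inj_onI) (metis IntE atMost_iff disjoint_iff)
      moreover have "h ` {..d} \<subseteq> J" using h by auto
      moreover have "finite J" using J(1) finite_subset by blast
      ultimately have "card {..d} \<le> card J" using card_inj_on_le by blast
      then show False using J(2) by simp
    qed
    then obtain t where t: "t \<le> d" "B t \<inter> J = {}" by blast
    then show "\<exists>c\<in>set (map x [0..<Suc d]). y \<otimes> c = c \<otimes> y"
      using commute[OF t(1) J(1) t(2) J(3)] by (intro bexI[of _ "x t"]) (auto simp: t(1) less_Suc_eq_le simp del: upt_Suc)
  qed (use X xs in auto)
  then show ?thesis using rho_CG_map_iso[OF \<alpha>(1)] by blast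
qed

end

section \<open>The action of the special linear group\<close>

lemma E_mat_eq_addrow_mat:
  assumes "i \<in> {1..n}" "j \<in> {1..n}" "i \<noteq> j"
  shows "E_mat n i j = addrow_mat n 1 (i - 1) (j - 1)"
  using assms by (intro eq_matI) (auto simp: E_mat_def)

lemma E_mat_SL:
  assumes "i \<in> {1..n}" "j \<in> {1..n}" "i \<noteq> j"
  shows "E_mat n i j \<in> carrier (SL_int n)"
proof -
  have "i - 1 \<noteq> j - 1" using assms by auto
  then show ?thesis
    by (simp add: E_mat_eq_addrow_mat[OF assms] SL_int_def det_addrow_mat)
qed

lemma inv_E_mat:
  assumes "i \<in> {1..n}" "j \<in> {1..n}" "i \<noteq> j"
  shows "inv\<^bsub>SL_int n\<^esub> (E_mat n i j) = addrow_mat n (- 1) (i - 1) (j - 1)"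
proof -
  interpret SL: group "SL_int n" by (rule SL_int_group)
  have ij: "i - 1 < n" "j - 1 < n" "i - 1 \<noteq> j - 1" using assms by auto
  have "addrow_mat n (- 1) (i - 1) (j - 1) * E_mat n i j = 1\<^sub>m n"
    using addrow_mat_inv[OF ij, of "- 1 :: int"] by (simp add: E_mat_eq_addrow_mat[OF assms])
  moreover have "addrow_mat n (- 1) (i - 1) (j - 1) \<in> carrier (SL_int n)"
    using det_addrow_mat[OF ij(3), of n "- 1 :: int"] by (simp add: SL_int_def)
  ultimately show ?thesis
    using E_mat_SL[OF assms] by (intro SL.inv_equality) (simp_all add: SL_int_def)
qed

text \<open>This factorization is what turns the swap into three elementary moves. Left
  multiplication by an elementary matrix is read as adding a multiple of one row to another.\<close>

lemma F_mat_eq: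
  assumes "i \<in> {1..n}" "j \<in> {1..n}" "i \<noteq> j"
  shows "F_mat n i j = E_mat n i j \<otimes>\<^bsub>SL_int n\<^esub> (inv\<^bsub>SL_int n\<^esub> (E_mat n j i) \<otimes>\<^bsub>SL_int n\<^esub> E_mat n i j)"
proof -
  have ij: "i - 1 < n" "j - 1 < n" "i - 1 \<noteq> j - 1" using assms by auto
  have E: "E_mat n i j \<in> carrier_mat n n" by (simp add: E_mat_def)
  have "F_mat n i j = addrow 1 (i - 1) (j - 1) (addrow (- 1) (j - 1) (i - 1) (E_mat n i j))"
    using ij by (intro eq_matI) (auto simp: F_mat_def E_mat_def)
  also have "\<dots> = E_mat n i j * (addrow_mat n (- 1) (j - 1) (i - 1) * E_mat n i j)"
    using addrow_mat[OF E ij(1)] addrow_mat[OF mult_carrier_mat[OF addrow_mat_carrier E] ij(2)]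
      E_mat_eq_addrow_mat[OF assms] by metis
  finally show ?thesis
    using inv_E_mat[OF assms(2,1)] assms(3) by (simp add: SL_int_def)
qed

lemma F_mat_SL:
  assumes "i \<in> {1..n}" "j \<in> {1..n}" "i \<noteq> j"
  shows "F_mat n i j \<in> carrier (SL_int n)"
proof -
  interpret SL: group "SL_int n" by (rule SL_int_group)
  show ?thesis
    unfolding F_mat_eq[OF assms] using E_mat_SL[OF assms] E_mat_SL[OF assms(2,1)] assms(3) by simp
qed

section \<open>Conjugation on a normal subgroup, and the abelianization\<close>

lemma (in normal) conj_iso:
  assumes g: "g \<in> carrier G"
  shows "(\<lambda>x. g \<otimes> x \<otimes> inv g) \<in> iso (G\<lparr>carrier := H\<rparr>) (G\<lparr>carrier := H\<rparr>)"
proof -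
  have "bij_betw (\<lambda>x. g \<otimes> x \<otimes> inv g) H H"
    by (rule bij_betw_byWitness[where f' = "\<lambda>x. inv g \<otimes> x \<otimes> g"])
      (use g inv_op_closed1 inv_op_closed2 in \<open>auto simp: m_assoc\<close>)
  moreover have "(\<lambda>x. g \<otimes> x \<otimes> inv g) \<in> hom (G\<lparr>carrier := H\<rparr>) (G\<lparr>carrier := H\<rparr>)"
    using g inv_op_closed2 by (auto simp: hom_def m_assoc)
  ultimately show ?thesis by (simp add: iso_def)
qed

lemma (in group) comm_group_abelianization: "comm_group (abelianization G)"
  unfolding abelianization_def by (rule derived_quot_is_comm_group)

lemma (in group) ab_class_hom: "ab_class G \<in> hom G (abelianization G)"
  unfolding abelianization_def ab_class_def[abs_def]
  by (rule normal.r_coset_hom_Mod[OF derived_self_is_normal])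

lemma (in group) carrier_abelianization: "carrier (abelianization G) = ab_class G ` carrier G"
  by (simp add: abelianization_def carrier_FactGroup ab_class_def[abs_def])

context two_groups
begin

text \<open>The derived subgroup lies in the second term of the lower central series, so characters
  of index 0 factor through the abelianization.\<close>

lemma char_ab_class:
  assumes f: "f \<in> characters 0" and xy: "x \<in> carrier G" "y \<in> carrier G" "ab_class G x = ab_class G y"
  shows "f x = f y"
proof -
  have D: "subgroup (derived G (carrier G)) G"
    by (rule G.derived_is_subgroup) simp
  have "x \<in> ab_class G y"
    using G.rcos_self[OF xy(1) D] xy(3) by (simp add: ab_class_def)
  then obtain e where e: "e \<in> derived G (carrier G)" "x = e \<otimes> y"
    by (auto simp: ab_class_def r_coset_def)
  then have "e \<in> lower_central G (Suc (Suc 0))" "e \<in> carrier G"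
    using G.derived_subset_lower_central subgroup.mem_carrier[OF D] by blast+
  then show ?thesis
    using e(2) char_mult[OF f, of e y] char_next[OF f] char_closed[OF f] xy(2) by simp
qed

text \<open>Reduces a sum of graded pieces to its summands: up to the derived subgroup,
  \<open>x\<close> is a word in preimages of elements of the pieces.\<close>

lemma char_subgroup_sum:
  assumes f: "f \<in> characters 0"
    and L: "\<And>I. I \<in> \<I> \<Longrightarrow> L I \<subseteq> carrier (abelianization G)"
    and kill: "\<And>I x. I \<in> \<I> \<Longrightarrow> x \<in> carrier G \<Longrightarrow> ab_class G x \<in> L I \<Longrightarrow> f x = \<one>\<^bsub>K\<^esub>"
    and x: "x \<in> carrier G" "ab_class G x \<in> subgroup_sum (abelianization G) L \<I>"
  shows "f x = \<one>\<^bsub>K\<^esub>"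
proof -
  define A where "A = {x \<in> carrier G. \<exists>I\<in>\<I>. ab_class G x \<in> L I}"
  have A: "A \<subseteq> carrier G" by (auto simp: A_def)
  interpret ab: group_hom G "abelianization G" "ab_class G"
    using G.comm_group_abelianization G.ab_class_hom
    by (simp add: group_hom_def group_hom_axioms_def comm_group_def)
  have "ab_class G ` A = (\<Union>I\<in>\<I>. L I)"
  proof
    show "(\<Union>I\<in>\<I>. L I) \<subseteq> ab_class G ` A"
    proof clarify
      fix v I assume v: "v \<in> L I" "I \<in> \<I>"
      then obtain y where "y \<in> carrier G" "v = ab_class G y"
        using L by (auto simp: G.carrier_abelianization)
      then show "v \<in> ab_class G ` A" using v by (auto simp: A_def)
    qed
  qed (auto simp: A_def)
  then have "ab_class G x \<in> ab_class G ` generate G A"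
    using x(2) ab.generate_img[OF A] by (simp add: subgroup_sum_def)
  then obtain y where y: "y \<in> generate G A" "ab_class G x = ab_class G y" by blast
  have "f y = \<one>\<^bsub>K\<^esub>"
    using y(1)
  proof (induction rule: generate.induct)
    case (eng h1 h2)
    then show ?case
      using char_mult[OF f, of h1 h2] G.generate_in_carrier[OF A] by simp
  qed (use A kill in \<open>auto simp: A_def char_one[OF f] char_inv[OF f]\<close>)
  then show ?thesis
    using char_ab_class[OF f x(1) G.generate_in_carrier[OF A y(1)] y(2)] by simp
qed

end

text \<open>Each matrix is realized by conjugation with its lifts to \<open>\<Gamma>\<close>. These
  are automorphisms of \<open>G\<close> inducing the given action on the abelianization, so the
  regularity conditions become statements about values of characters.\<close>

lemma regular_group_abelianization:
  fixes \<Gamma> G :: "('a, 'b) monoid_scheme" and K :: "('c, 'd) monoid_scheme"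
  assumes "group \<Gamma>" and H: "H \<lhd> \<Gamma>" and G: "G = \<Gamma>\<lparr>carrier := H\<rparr>"
    and n_group: "n_group n G GI" and pc: "partially_commuting n G GI"
    and \<phi>: "\<phi> \<in> hom (SL_int n) (\<Gamma> Mod H)"
    and regular: "regular_module n (abelianization G) (ab_action \<Gamma> H \<phi>) L"
    and degree: "grading_degree n (abelianization G) L \<le> d"
    and image: "\<And>I. I \<subseteq> {1..n} \<Longrightarrow> d \<le> card I \<Longrightarrow>
      subgroup_sum (abelianization G) L {J. J \<subseteq> I} \<subseteq> ab_class G ` GI I"
    and "group K"
  shows "regular_group G K n d GI (\<lambda>I. {x \<in> carrier G. ab_class G x \<in> L I})
    (\<lambda>i j. {(\<lambda>x. c \<otimes>\<^bsub>\<Gamma>\<^esub> x \<otimes>\<^bsub>\<Gamma>\<^esub> inv\<^bsub>\<Gamma>\<^esub> c) | c A. c \<in> \<phi> A \<and>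
      A \<in> {E_mat n i j, inv\<^bsub>SL_int n\<^esub> (E_mat n i j), E_mat n j i, inv\<^bsub>SL_int n\<^esub> (E_mat n j i)}})"
proof -
  interpret N: normal H \<Gamma> by fact
  have "group G" unfolding G by (rule N.subgroup_imp_group[OF N.subgroup_axioms])
  then interpret two_groups G K using \<open>group K\<close> by (simp add: two_groups_def)
  interpret SL: group "SL_int n" by (rule SL_int_group)
  define V where "V = abelianization G"
  define act where "act = ab_action \<Gamma> H \<phi>"
  define cl where "cl = ab_class G"
  define W1 where "W1 I = {x \<in> carrier G. cl x \<in> L I}" for I
  define mats where "mats i j = {E_mat n i j, inv\<^bsub>SL_int n\<^esub> (E_mat n i j), E_mat n j i,
    inv\<^bsub>SL_int n\<^esub> (E_mat n j i)}" for i j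
  define conj where "conj c x = c \<otimes>\<^bsub>\<Gamma>\<^esub> x \<otimes>\<^bsub>\<Gamma>\<^esub> inv\<^bsub>\<Gamma>\<^esub> c" for c x
  define E where "E i j = {conj c | c A. c \<in> \<phi> A \<and> A \<in> mats i j}" for i j
  interpret cl: group_hom G V cl
    using G.comm_group_abelianization G.ab_class_hom
    by (simp add: V_def cl_def group_hom_def group_hom_axioms_def comm_group_def)
  have V: "carrier V = cl ` carrier G" by (simp add: V_def cl_def G.carrier_abelianization)
  have carrier: "carrier G = H" by (simp add: G)
  have R: "regular_module n V act L" using regular by (simp add: V_def act_def)
  note R' = R[unfolded regular_module_def, THEN conjunct2, THEN conjunct2]
  have reg: "SL_module n V act" "n_grading n V L" using R by (simp_all add: regular_module_def)
  have inert: "act (E_mat n i j) v = v"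
    if "I \<subseteq> {1..n}" "i \<in> {1..n}" "j \<in> {1..n}" "i \<noteq> j" "I \<inter> {i, j} = {}" "v \<in> L I" for I i j v
    by (rule R'[THEN conjunct1, rule_format, of I]) (use that in auto)
  have exchange: "act A v \<otimes>\<^bsub>V\<^esub> inv\<^bsub>V\<^esub> v \<in> subgroup_sum V L {(I \<union> {j}) - {i}, I \<union> {j}}"
    if "I \<subseteq> {1..n}" "i \<in> I" "j \<in> {1..n} - I" "A \<in> mats i j" "v \<in> L I" for I i j A v
    by (rule R'[THEN conjunct2, THEN conjunct1, rule_format]) (use that in \<open>simp_all add: mats_def\<close>)
  have swap: "act (F_mat n i j) ` L I = L (Transposition.transpose i j ` I)"
    if "I \<subseteq> {1..n}" "i \<in> {1..n}" "j \<in> {1..n}" "i \<noteq> j" for I i j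
    by (rule R'[THEN conjunct2, THEN conjunct2, rule_format]) (use that in simp)
  have LV: "L I \<subseteq> carrier V" if "I \<subseteq> {1..n}" for I
    using reg(2) that subgroup.subset unfolding n_grading_def by blast
  have act_mult: "act (A \<otimes>\<^bsub>SL_int n\<^esub> B) v = act A (act B v)"
    if "A \<in> carrier (SL_int n)" "B \<in> carrier (SL_int n)" "v \<in> carrier V" for A B v
    using reg(1) that unfolding SL_module_def by blast
  have act_inv: "act (inv\<^bsub>SL_int n\<^esub> A) (act A v) = v" if "A \<in> carrier (SL_int n)" "v \<in> carrier V" for A v
    using act_mult[OF SL.inv_closed[OF that(1)] that] reg(1) that unfolding SL_module_def by simp
  have mats_SL: "mats i j \<subseteq> carrier (SL_int n)" if "i \<in> {1..n}" "j \<in> {1..n}" "i \<noteq> j" for i j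
    using E_mat_SL[OF that] E_mat_SL[OF that(2,1)] that(3) by (simp add: mats_def)
  have \<phi>_Mod: "\<phi> A \<in> carrier (\<Gamma> Mod H)" if "A \<in> carrier (SL_int n)" for A
    using \<phi> that by (auto simp: hom_def)
  have lift_exists: "\<exists>c. c \<in> \<phi> A" if "A \<in> carrier (SL_int n)" for A
    using \<phi>_Mod[OF that] N.rcos_self[OF _ N.subgroup_axioms] by (auto simp: carrier_FactGroup)
  have lift_carrier: "c \<in> carrier \<Gamma>" if "A \<in> carrier (SL_int n)" "c \<in> \<phi> A" for A c
    using \<phi>_Mod[OF that(1)] that(2) N.r_coset_subset_G[OF N.subset] by (auto simp: carrier_FactGroup)
  have conj_iso: "conj c \<in> iso G G" if "A \<in> carrier (SL_int n)" "c \<in> \<phi> A" for A c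
    using N.conj_iso[OF lift_carrier[OF that]] by (simp add: G conj_def[abs_def])
  have conj_closed: "conj c x \<in> carrier G" if "A \<in> carrier (SL_int n)" "c \<in> \<phi> A" "x \<in> carrier G" for A c x
    using conj_iso[OF that(1,2)] that(3) by (auto simp: iso_def hom_def)
  have cl_conj: "cl (conj c x) = act A (cl x)" if "A \<in> carrier (SL_int n)" "c \<in> \<phi> A" "x \<in> carrier G" for A c x
    using ab_action_class[of H \<Gamma> \<phi> A c x] H \<phi>_Mod[OF that(1)] that(2,3)
    by (simp add: cl_def act_def conj_def carrier G[symmetric])
  have cl_eq: "f x = f y" if "f \<in> characters 0" "x \<in> carrier G" "y \<in> carrier G" "cl x = cl y" for f x y
    using char_ab_class that by (simp add: cl_def)
  have L_sum: "f x = \<one>\<^bsub>K\<^esub>"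
    if "f \<in> characters 0" "\<And>I. I \<in> \<I> \<Longrightarrow> I \<subseteq> {1..n}" "\<And>I x. I \<in> \<I> \<Longrightarrow> x \<in> W1 I \<Longrightarrow> f x = \<one>\<^bsub>K\<^esub>"
      "x \<in> carrier G" "cl x \<in> subgroup_sum V L \<I>" for f \<I> x
    using char_subgroup_sum[of f \<I> L x] that LV by (simp add: W1_def V_def cl_def)
  have "regular_group G K n d GI W1 E"
  proof (unfold_locales)
    show "n_group n G GI" "partially_commuting n G GI" by fact+
    show "W1 I \<subseteq> carrier G" for I by (auto simp: W1_def)
    show "\<epsilon> \<in> iso G G" if ij: "i \<in> {1..n}" "j \<in> {1..n}" "i \<noteq> j" and "\<epsilon> \<in> E i j" for i j \<epsilon>
      using that(4) conj_iso mats_SL[OF ij] by (auto simp: E_def)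
    show "f x = \<one>\<^bsub>K\<^esub>" if f: "f \<in> characters 0" and "\<And>I x. I \<subseteq> {1..n} \<Longrightarrow> x \<in> W1 I \<Longrightarrow> f x = \<one>\<^bsub>K\<^esub>"
      and x: "x \<in> carrier G" for f x
    proof (rule L_sum[OF f _ _ x])
      show "cl x \<in> subgroup_sum V L {I. I \<subseteq> {1..n}}"
        using reg(2) x by (simp add: n_grading_def)
    qed (use that in auto)
    show "f (\<epsilon> x) = f x"
      if ij: "i \<in> {1..n}" "j \<in> {1..n}" "i \<noteq> j" and \<epsilon>: "\<epsilon> \<in> E i j" and I: "I \<subseteq> {1..n}" "I \<inter> {i, j} = {}"
        and x: "x \<in> W1 I" and f: "f \<in> characters 0" for i j \<epsilon> I x f
    proof -
      obtain c A where c: "\<epsilon> = conj c" "c \<in> \<phi> A" "A \<in> mats i j" using \<epsilon> by (auto simp: E_def)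
      have A: "A \<in> carrier (SL_int n)" using c(3) mats_SL[OF ij] by blast
      have x': "x \<in> carrier G" "cl x \<in> L I" using x by (auto simp: W1_def)
      have fixed: "act (E_mat n i j) (cl x) = cl x" "act (E_mat n j i) (cl x) = cl x"
        using inert[OF I(1) ij I(2) x'(2)] inert[OF I(1) ij(2,1) _ _ x'(2)] ij(3) I(2) by auto
      \<comment> \<open>Condition (1) speaks of elementary matrices only; their inverses fix the
        same vectors.\<close>
      have "act A (cl x) = cl x"
        using c(3) fixed act_inv[OF E_mat_SL[OF ij], of "cl x"]
          act_inv[OF E_mat_SL[OF ij(2,1) ij(3)[symmetric]], of "cl x"] x'(1)
        by (auto simp: mats_def)
      then show ?thesis
        unfolding c(1) using cl_eq[OF f conj_closed[OF A c(2) x'(1)] x'(1)] cl_conj[OF A c(2) x'(1)] by simp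
    qed
    show "f (\<epsilon> x) = f x"
      if I: "I \<subseteq> {1..n}" "i \<in> I" "j \<in> {1..n} - I" and \<epsilon>: "\<epsilon> \<in> E i j"
        and x: "x \<in> W1 I" and f: "f \<in> characters 0"
        and kill: "\<And>y. y \<in> W1 (insert j (I - {i})) \<union> W1 (insert j I) \<Longrightarrow> f y = \<one>\<^bsub>K\<^esub>" for i j \<epsilon> I x f
    proof -
      obtain c A where c: "\<epsilon> = conj c" "c \<in> \<phi> A" "A \<in> mats i j" using \<epsilon> by (auto simp: E_def)
      have A: "A \<in> carrier (SL_int n)" using c(3) mats_SL[of i j] I by blast
      have x': "x \<in> carrier G" "cl x \<in> L I" using x by (auto simp: W1_def)
      note cx = conj_closed[OF A c(2) x'(1)]
      have sets: "I \<union> {j} = insert j I" "insert j I - {i} = insert j (I - {i})" using I by auto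
      \<comment> \<open>The class of this element is \<open>gv - v\<close> of condition (2), written
        multiplicatively.\<close>
      have "f (conj c x \<otimes>\<^bsub>G\<^esub> inv\<^bsub>G\<^esub> x) = \<one>\<^bsub>K\<^esub>"
      proof (rule L_sum[OF f])
        show "cl (conj c x \<otimes>\<^bsub>G\<^esub> inv\<^bsub>G\<^esub> x) \<in> subgroup_sum V L {insert j (I - {i}), insert j I}"
          using exchange[OF I c(3) x'(2), unfolded sets] cx x'(1) by (simp add: cl_conj[OF A c(2) x'(1)])
      qed (use I kill cx x'(1) in auto)
      then show ?thesis
        unfolding c(1) using cx x'(1) char_closed[OF f] char_mult[OF f, of "conj c x" "inv\<^bsub>G\<^esub> x"] char_inv[OF f, of x]
        by (simp add: K.inv_solve_right')
    qed
    show "\<exists>\<epsilon>\<^sub>1\<in>E i j. \<exists>\<epsilon>\<^sub>2\<in>E i j. \<exists>\<epsilon>\<^sub>3\<in>E i j. \<forall>I. I \<subseteq> {1..n} \<longrightarrow>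
        W1 (Transposition.transpose i j ` I) \<subseteq> (\<lambda>x. \<epsilon>\<^sub>1 (\<epsilon>\<^sub>2 (\<epsilon>\<^sub>3 x))) ` W1 I"
      if ij: "i \<in> {1..n}" "j \<in> {1..n}" "i \<noteq> j" for i j
    proof -
      let ?A = "E_mat n i j" and ?B = "inv\<^bsub>SL_int n\<^esub> (E_mat n j i)"
      have AB: "?A \<in> carrier (SL_int n)" "?B \<in> carrier (SL_int n)"
        using E_mat_SL[OF ij] E_mat_SL[OF ij(2,1)] ij(3) by auto
      obtain a b where ab: "a \<in> \<phi> ?A" "b \<in> \<phi> ?B" using lift_exists AB by blast
      have E: "conj a \<in> E i j" "conj b \<in> E i j" using ab by (auto simp: E_def mats_def)
      \<comment> \<open>Lifts of the three factors of \<open>F_mat n i j\<close>, so that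
        \<open>\<beta>\<close> induces its action.\<close>
      define \<beta> where "\<beta> x = conj a (conj b (conj a x))" for x
      have cl_\<beta>: "cl (\<beta> x) = act (F_mat n i j) (cl x)" if x: "x \<in> carrier G" for x
      proof -
        note ca = conj_closed[OF AB(1) ab(1) x]
        note cba = conj_closed[OF AB(2) ab(2) ca]
        have "cl (\<beta> x) = act ?A (cl (conj b (conj a x)))"
          unfolding \<beta>_def by (rule cl_conj[OF AB(1) ab(1) cba])
        also have "\<dots> = act ?A (act ?B (cl (conj a x)))"
          by (simp only: cl_conj[OF AB(2) ab(2) ca])
        also have "\<dots> = act ?A (act (?B \<otimes>\<^bsub>SL_int n\<^esub> ?A) (cl x))"
          by (simp only: cl_conj[OF AB(1) ab(1) x] act_mult[OF AB(2,1) cl.hom_closed[OF x]])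
        also have "\<dots> = act (F_mat n i j) (cl x)"
          using act_mult[OF AB(1) SL.m_closed[OF AB(2,1)] cl.hom_closed[OF x]] F_mat_eq[OF ij] by simp
        finally show ?thesis .
      qed
      have "(conj a \<circ> (conj b \<circ> conj a)) \<in> iso G G"
        using iso_set_trans[of _ G G _ G] conj_iso[OF AB(1) ab(1)] conj_iso[OF AB(2) ab(2)] by simp
      then have surj: "\<beta> ` carrier G = carrier G"
        by (simp add: iso_def bij_betw_def \<beta>_def[abs_def] comp_def)
      have "W1 (Transposition.transpose i j ` I) \<subseteq> \<beta> ` W1 I" if I: "I \<subseteq> {1..n}" for I
      proof
        fix y assume "y \<in> W1 (Transposition.transpose i j ` I)"
        then have y: "y \<in> carrier G" "cl y \<in> act (F_mat n i j) ` L I"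
          using swap[OF I ij] by (auto simp: W1_def)
        obtain x where x: "x \<in> carrier G" "y = \<beta> x" using y(1) surj by blast
        obtain v where v: "v \<in> L I" "cl y = act (F_mat n i j) v" using y(2) by blast
        \<comment> \<open>\<open>F_mat n i j\<close> acts injectively, so the
          \<open>\<beta>\<close>-preimage of \<open>y\<close> has its class in
          \<open>L I\<close>.\<close>
        have "cl x = v"
          using act_inv[OF F_mat_SL[OF ij]] cl_\<beta>[OF x(1)] v x LV[OF I] by (metis cl.hom_closed subsetD)
        then show "y \<in> \<beta> ` W1 I" using x v(1) by (auto simp: W1_def)
      qed
      then show ?thesis using E unfolding \<beta>_def by blast
    qed
    show "\<exists>x'\<in>GI B. \<forall>f\<in>characters 0. f x' = f x"
      if B: "I \<subseteq> B" "B \<subseteq> {1..n}" "d \<le> card B" and x: "x \<in> W1 I" for I B x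
    proof -
      have "cl x \<in> subgroup_sum V L {J. J \<subseteq> B}"
        using x B(1) unfolding subgroup_sum_def W1_def by (intro generate.incl) blast
      then obtain x' where x': "x' \<in> GI B" "cl x = cl x'"
        using image[OF B(2,3)] by (auto simp: V_def cl_def)
      have "x' \<in> carrier G"
        using n_group B(2) x'(1) subgroup.mem_carrier unfolding n_group_def by metis
      then show ?thesis
        using cl_eq x x' by (intro bexI[OF _ x'(1)]) (auto simp: W1_def)
    qed
    show "f x = \<one>\<^bsub>K\<^esub>" if I: "I \<subseteq> {1..n}" "d < card I" and x: "x \<in> W1 I" and f: "f \<in> characters 0" for I x f
    proof -
      let ?P = "\<lambda>k. \<forall>I. I \<subseteq> {1..n} \<and> k < card I \<longrightarrow> L I = {\<one>\<^bsub>V\<^esub>}"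
      \<comment> \<open>The minimum defining the degree is attained, since \<open>n\<close> itself
        satisfies the condition.\<close>
      have "card I \<le> n" if "I \<subseteq> {1..n}" for I using card_mono[OF _ that] by simp
      then have "?P n" by (meson not_le)
      then have "?P (grading_degree n V L)" unfolding grading_degree_def by (rule LeastI)
      then have "L I = {\<one>\<^bsub>V\<^esub>}" using I degree by (auto simp: V_def)
      then have "cl x = cl \<one>\<^bsub>G\<^esub>" "x \<in> carrier G" using x by (auto simp: W1_def)
      then show ?thesis using cl_eq[OF f, of x "\<one>\<^bsub>G\<^esub>"] char_one[OF f] by simp
    qed
  qed
  then show ?thesis
    by (simp add: W1_def[abs_def] E_def[abs_def] conj_def[abs_def] mats_def cl_def)
qed

theorem theorem6p1:
  fixes d n N :: nat
    and \<Gamma> :: "('a, 'b) monoid_scheme"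
    and H :: "'a set"
    and G :: "('a, 'b) monoid_scheme"
    and GI :: "nat set \<Rightarrow> 'a set"
    and \<phi> :: "int mat \<Rightarrow> 'a set"
    and L :: "nat set \<Rightarrow> 'a set set"
    and K :: "('c, 'd) monoid_scheme"
    and \<rho> :: "'a \<Rightarrow> 'c"
  assumes "group \<Gamma>" and "H \<lhd> \<Gamma>" and "G = \<Gamma>\<lparr>carrier := H\<rparr>"
    and "finitely_generated G"
    and "n_group n G GI" and "generated_in_degree d n G GI"
    and "\<phi> \<in> hom (SL_int n) (\<Gamma> Mod H)"
    and "N \<ge> 1"
    and "(partially_commuting n G GI \<and>
          (regular_module n (abelianization G) (ab_action \<Gamma> H \<phi>) L \<and>
            grading_degree n (abelianization G) L \<le> d) \<and>
          (\<forall>I. I \<subseteq> {1..n} \<and> card I \<ge> d \<longrightarrow>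
            subgroup_sum (abelianization G) L {J. J \<subseteq> I} \<subseteq> ab_class G ` GI I) \<and>
          int n \<ge> int d * (int d + 1) * (int N - 1))
       \<or> (partially_commuting n G GI \<and>
          (regular_module n (abelianization G) (ab_action \<Gamma> H \<phi>) L \<and>
            grading_degree n (abelianization G) L \<le> d) \<and>
          (\<forall>I. I \<subseteq> {1..n} \<and> card I \<ge> d \<longrightarrow>
            subgroup_sum (abelianization G) L {J. J \<subseteq> I} \<subseteq> ab_class G ` GI I) \<and>
          weakly_commuting n G GI \<and>
          int n \<ge> (int d + 1) + ((int d)\<^sup>2 - 1) * (int N - 1))"
    and "group K" and "\<rho> \<in> hom G K"
    and "\<exists>x\<in>carrier G. \<rho> x \<noteq> \<one>\<^bsub>K\<^esub>"
    and "lower_central G N \<subseteq> kernel G K \<rho>"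
  shows "\<exists>gs. rho_CG G K \<rho> gs"
proof -
  interpret N: normal H \<Gamma> by fact
  have "group G" unfolding assms(3) by (rule N.subgroup_imp_group[OF N.subgroup_axioms])
  have pc: "partially_commuting n G GI"
    and reg: "regular_module n (abelianization G) (ab_action \<Gamma> H \<phi>) L"
    and deg: "grading_degree n (abelianization G) L \<le> d"
    and image: "\<And>I. I \<subseteq> {1..n} \<Longrightarrow> d \<le> card I \<Longrightarrow>
      subgroup_sum (abelianization G) L {J. J \<subseteq> I} \<subseteq> ab_class G ` GI I"
    using assms(9) by (elim disjE conjE; simp)+
  interpret regular_group G K n d GI "\<lambda>I. {x \<in> carrier G. ab_class G x \<in> L I}"
    "\<lambda>i j. {(\<lambda>x. c \<otimes>\<^bsub>\<Gamma>\<^esub> x \<otimes>\<^bsub>\<Gamma>\<^esub> inv\<^bsub>\<Gamma>\<^esub> c) | c A. c \<in> \<phi> A \<and>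
      A \<in> {E_mat n i j, inv\<^bsub>SL_int n\<^esub> (E_mat n i j), E_mat n j i, inv\<^bsub>SL_int n\<^esub> (E_mat n j i)}}"
    by (rule regular_group_abelianization[OF assms(1-3,5) pc assms(7) reg deg image assms(10)])
  define M where "M = N - 1"
  define P where "P k \<longleftrightarrow> (\<forall>x\<in>lower_central G (Suc k). \<rho> x = \<one>\<^bsub>K\<^esub>)" for k
  have PN: "P M"
    using assms(8,13) by (auto simp: P_def M_def kernel_def)
  \<comment> \<open>Nontriviality of \<open>\<rho>\<close> excludes 0. The least index is
    \<open>Suc c\<close>, so \<open>lower_central G (Suc c)\<close> is a term on which
    \<open>\<rho>\<close> is nontrivial while it is trivial on the next one.\<close>
  have "(LEAST k. P k) \<noteq> 0" using LeastI[of P, OF PN] assms(12) by (metis P_def lower_central_one)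
  then obtain c where c: "(LEAST k. P k) = Suc c" using not0_implies_Suc by blast
  have "P (Suc c)" using LeastI[of P, OF PN] c by simp
  then have trivial: "\<And>x. x \<in> lower_central G (Suc (Suc c)) \<Longrightarrow> \<rho> x = \<one>\<^bsub>K\<^esub>" by (simp add: P_def)
  have "\<not> P c" using not_less_Least[of c P] c by simp
  then have nontrivial: "\<exists>x\<in>lower_central G (Suc c). \<rho> x \<noteq> \<one>\<^bsub>K\<^esub>" by (simp add: P_def)
  have cN: "Suc c \<le> M" using Least_le[of P, OF PN] c by simp
  have N1: "int N - 1 = int M" using assms(8) by (simp add: M_def)
  \<comment> \<open>Both cases say \<open>(d + 1) * k \<le> n\<close> for the respective degree
    bound \<open>k\<close>. The second rests on
    \<open>(d + 1) + (d^2 - 1) M = (d + 1) ((d - 1) M + 1)\<close> and on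
    \<open>Suc c \<le> M\<close>.\<close>
  consider "(d + 1) * (Suc c * d) \<le> n"
    | "1 \<le> d" "weakly_commuting n G GI" "(d + 1) * (Suc c * (d - 1) + 1) \<le> n"
    using assms(9)
  proof (elim disjE conjE)
    assume "int n \<ge> int d * (int d + 1) * (int N - 1)"
    then have "int (d * (d + 1) * M) \<le> int n" unfolding N1 by (simp add: algebra_simps)
    then have "(d + 1) * (d * M) \<le> n" unfolding of_nat_le_iff by (simp add: algebra_simps)
    moreover have "(d + 1) * (Suc c * d) \<le> (d + 1) * (d * M)"
      using mult_le_mono1[OF cN, of d] by (intro mult_le_mono2) (simp add: mult.commute)
    ultimately show thesis using that(1) order_trans by blast
  next
    assume n: "int n \<ge> (int d + 1) + ((int d)\<^sup>2 - 1) * (int N - 1)" and weak: "weakly_commuting n G GI"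
    show thesis
    proof (cases d)
      \<comment> \<open>Truncated subtraction would spoil the identity here, but the first
        alternative reads \<open>0 \<le> n\<close>.\<close>
      case 0
      then show ?thesis using that(1) by simp
    next
      case (Suc e)
      have "int ((d + 1) * (e * M + 1)) \<le> int n"
        using n unfolding N1 Suc by (simp add: algebra_simps power2_eq_square)
      then have "(d + 1) * (e * M + 1) \<le> n" unfolding of_nat_le_iff .
      moreover have "(d + 1) * (Suc c * e + 1) \<le> (d + 1) * (e * M + 1)"
        using mult_le_mono2[OF cN, of e] by (intro mult_le_mono2) (simp add: mult.commute)
      ultimately have "(d + 1) * (Suc c * e + 1) \<le> n" by (rule order_trans[rotated])
      then show ?thesis using that(2) weak Suc by simp
    qed
  qed
  then show ?thesis
  proof cases
    case 1
    show ?thesis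
      by (rule exists_rho_CG[OF assms(11) _ nontrivial _ _ 1 assms(4,6)]; (rule trivial W_degree)?) simp_all
  next
    case 2
    define k where "k = Suc c * (d - 1) + 1"
    \<comment> \<open>The degree bound under weak commutativity asks for \<open>k < n\<close>, which
      follows from \<open>2 k \<le> (d + 1) k \<le> n\<close>.\<close>
    have "0 < k" by (simp add: k_def)
    moreover have "2 * k \<le> (d + 1) * k" using 2(1) by (intro mult_le_mono1) simp
    moreover have "(d + 1) * k \<le> n" using 2(3) unfolding k_def .
    ultimately have "k < n" by linarith
    then have small: "Suc c * (d - 1) + 1 < n" unfolding k_def .
    show ?thesis
    proof (rule exists_rho_CG[OF assms(11) trivial nontrivial _ _ 2(3) assms(4,6)])
      show "f x = \<one>\<^bsub>K\<^esub>"
        if "I \<subseteq> {1..n}" "Suc c * (d - 1) + 1 < card I" "x \<in> W c I" "f \<in> characters c" for I x f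
        using W_degree_weakly_commuting[OF 2(2,1) that(1,2) small that(3,4)] .
      show "d \<le> Suc c * (d - 1) + 1" using 2(1) by simp
    qed
  qed
qed

end
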